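(* Let $p$ be a prime number, let $R$ be a perfect $\mathbb{F}_p$-algebra, and let $W$ be a strict $p$-ring with residue algebra $R$. Then $C(R)$ is isomorphic to $W$ as a ring, and hence $C(R)$ is a strict $p$-ring.
   Context: All rings are commutative with $1$ and ring homomorphisms map $1$ to $1$. An $\mathbb{F}_p$-algebra $R$ is perfect if the Frobenius $x \mapsto x^p$ is an isomorphism of $R$. A $p$-ring is a commutative ring $A$ with unit which is Hausdorff and complete for the topology defined by a sequence of ideals $\mathfrak{a}_1 \supset \mathfrak{a}_2 \supset \cdots$ such that (1) $\mathfrak{a}_i \mathfrak{a}_j \subset \mathfrak{a}_{i+j}$ for $i,j \ge 1$, and (2) $A/\mathfrak{a}_1$ is a perfect $\mathbb{F}_p$-algebra (called the residue algebra of $A$). A $p$-ring is called strict if $\mathfrak{a}_i = p^i A$ for all $i\ge 1$ and $p$ is not a zero divisor in $A$. For example, the ring $W(R)$ of $p$-typical Witt vectors of $R$ is a strict $p$-ring with residue algebra $R$. $\mathbb{Z}R$ denotes the monoid algebra over $\mathbb{Z}$ of the multiplicative monoid $(R,\cdot)$; its elements are finite formal sums $\sum_{r\in R} n_r [r]$ with $n_r \in \mathbb{Z}$, and $[r][s]=[rs]$ (so $[1]=1$, but $[0]$ is in general not $0$). Let $\pi : \mathbb{Z}R \to R$ be the surjective ring homomorphism $\sum n_r[r] \mapsto \sum n_r r$ and $I = \ker \pi$. Define $C(R) = \varprojlim_{\nu} \mathbb{Z}R/I^{\nu}$, the $I$-adic completion of $\mathbb{Z}R$, which is regarded as a $p$-ring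 with residue algebra $R$ via the ideals $\mathfrak{a}_i = \widehat{I^i} = \varprojlim_{\nu} I^i/I^{\nu} \subset C(R)$ (limit over $\nu \ge i$). *)

theory Defs
  imports
    "HOL-Analysis.T1_Spaces"
    "HOL-Library.Poly_Mapping"
    "HOL-Algebra.Ideal_Product"
    "HOL-Algebra.IntRing"
begin

section \<open>Perfect algebras over the prime field\<close>

text \<open>
  A ring carries at most one structure of algebra over \<open>\<int>/p\<close>, so being such an algebra is the
  existence of a (unital) ring homomorphism from \<open>\<int>/p\<close>. The zero ring is allowed.
\<close>

definition Fp_algebra :: "nat \<Rightarrow> ('a, 'm) ring_scheme \<Rightarrow> bool" where
  "Fp_algebra p R \<longleftrightarrow> cring R \<and> (\<exists>\<phi>. \<phi> \<in> ring_hom (ZFact (int p)) R)"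

definition perfect_Fp_algebra :: "nat \<Rightarrow> ('a, 'm) ring_scheme \<Rightarrow> bool" where
  "perfect_Fp_algebra p R \<longleftrightarrow> Fp_algebra p R \<and> (\<lambda>x. x [^]\<^bsub>R\<^esub> p) \<in> ring_iso R R"


section \<open>The topology defined by a sequence of ideals\<close>

text \<open>Sequences of ideals are indexed by \<open>i \<ge> 1\<close>; the value at \<open>0\<close> is irrelevant throughout.\<close>

definition ideal_topology :: "('a, 'm) ring_scheme \<Rightarrow> (nat \<Rightarrow> 'a set) \<Rightarrow> 'a topology" where
  "ideal_topology A \<aa> =
     topology (\<lambda>U. U \<subseteq> carrier A \<and> (\<forall>x\<in>U. \<exists>i\<ge>1. \<aa> i +>\<^bsub>A\<^esub> x \<subseteq> U))"

lemma openin_ideal_topology: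
  assumes dec: "\<And>i. i \<ge> 1 \<Longrightarrow> \<aa> (Suc i) \<subseteq> \<aa> i"
  shows "openin (ideal_topology A \<aa>) U \<longleftrightarrow>
           U \<subseteq> carrier A \<and> (\<forall>x\<in>U. \<exists>i\<ge>1. \<aa> i +>\<^bsub>A\<^esub> x \<subseteq> U)"
proof -
  have anti: "\<aa> j \<subseteq> \<aa> i" if "1 \<le> i" "i \<le> j" for i j
    using that(2) by (induction j rule: dec_induct) (use dec that(1) in \<open>auto intro: order_trans\<close>)
  have mono: "\<aa> j +>\<^bsub>A\<^esub> x \<subseteq> \<aa> i +>\<^bsub>A\<^esub> x" if "1 \<le> i" "i \<le> j" for i j x
    using anti[OF that] by (auto simp: a_r_coset_def')
  let ?P = "\<lambda>U. U \<subseteq> carrier A \<and> (\<forall>x\<in>U. \<exists>i\<ge>1. \<aa> i +>\<^bsub>A\<^esub> x \<subseteq> U)"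
  have "istopology ?P"
    unfolding istopology_def
  proof (intro conjI allI impI)
    fix S T assume S: "?P S" and T: "?P T"
    show "S \<inter> T \<subseteq> carrier A" using S by blast
    show "\<forall>x\<in>S \<inter> T. \<exists>i\<ge>1. \<aa> i +>\<^bsub>A\<^esub> x \<subseteq> S \<inter> T"
    proof
      fix x assume "x \<in> S \<inter> T"
      then obtain i j where ij: "i \<ge> 1" "\<aa> i +>\<^bsub>A\<^esub> x \<subseteq> S" "j \<ge> 1" "\<aa> j +>\<^bsub>A\<^esub> x \<subseteq> T"
        using S T by (metis IntE)
      then have "\<aa> (max i j) +>\<^bsub>A\<^esub> x \<subseteq> S \<inter> T"
        using mono[of i "max i j" x] mono[of j "max i j" x] by fastforce
      then show "\<exists>i\<ge>1. \<aa> i +>\<^bsub>A\<^esub> x \<subseteq> S \<inter> T"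
        using ij by (intro exI[of _ "max i j"]) auto
    qed
  next
    fix \<K> assume K: "\<forall>S\<in>\<K>. ?P S"
    show "\<Union>\<K> \<subseteq> carrier A" using K by blast
    show "\<forall>x\<in>\<Union>\<K>. \<exists>i\<ge>1. \<aa> i +>\<^bsub>A\<^esub> x \<subseteq> \<Union>\<K>"
      using K by (meson Union_iff Union_upper order_trans)
  qed
  then show ?thesis
    unfolding ideal_topology_def by (simp add: topology_inverse')
qed

text \<open>
  The topology has a countable neighbourhood base at \<open>0\<close>, so completeness is convergence of
  Cauchy sequences.
\<close>

definition ideal_Cauchy :: "('a, 'm) ring_scheme \<Rightarrow> (nat \<Rightarrow> 'a set) \<Rightarrow> (nat \<Rightarrow> 'a) \<Rightarrow> bool" where
  "ideal_Cauchy A \<aa> s \<longleftrightarrow>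
     range s \<subseteq> carrier A \<and> (\<forall>i\<ge>1. \<exists>N. \<forall>m\<ge>N. \<forall>n\<ge>N. s m \<ominus>\<^bsub>A\<^esub> s n \<in> \<aa> i)"

definition ideal_complete :: "('a, 'm) ring_scheme \<Rightarrow> (nat \<Rightarrow> 'a set) \<Rightarrow> bool" where
  "ideal_complete A \<aa> \<longleftrightarrow>
     (\<forall>s. ideal_Cauchy A \<aa> s \<longrightarrow> (\<exists>l. limitin (ideal_topology A \<aa>) s l sequentially))"


section \<open>\<open>p\<close>-rings\<close>

locale p_ring = cring A for A (structure) +
  fixes p :: nat and \<aa> :: "nat \<Rightarrow> 'a set"
  assumes ideal_seq: "i \<ge> 1 \<Longrightarrow> ideal (\<aa> i) A"
    and decreasing: "i \<ge> 1 \<Longrightarrow> \<aa> (Suc i) \<subseteq> \<aa> i"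
    and ideal_prod_le: "\<lbrakk>i \<ge> 1; j \<ge> 1\<rbrakk> \<Longrightarrow> \<aa> i \<cdot> \<aa> j \<subseteq> \<aa> (i + j)"
    and Hausdorff: "Hausdorff_space (ideal_topology A \<aa>)"
    and complete: "ideal_complete A \<aa>"
    and residue_perfect: "perfect_Fp_algebra p (A Quot \<aa> 1)"

locale strict_p_ring = p_ring +
  assumes ideal_eq_power: "i \<ge> 1 \<Longrightarrow> \<aa> i = PIdl (add_pow A (p ^ i) \<one>)"
    and p_not_zero_divisor: "\<lbrakk>x \<in> carrier A; add_pow A p \<one> \<otimes> x = \<zero>\<rbrakk> \<Longrightarrow> x = \<zero>"


section \<open>The integral monoid algebra and its completion\<close>

definition monoid_algebra_Z :: "('a, 'm) monoid_scheme \<Rightarrow> ('a \<Rightarrow>\<^sub>0 int) ring" where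
  "monoid_algebra_Z M =
     \<lparr>carrier = {c. Poly_Mapping.keys c \<subseteq> carrier M},
      monoid.mult = (\<lambda>a b. frag_extend (\<lambda>r. frag_extend (\<lambda>s. frag_of (r \<otimes>\<^bsub>M\<^esub> s)) b) a),
      one = frag_of \<one>\<^bsub>M\<^esub>,
      ring.zero = 0,
      add = (+)\<rparr>"

definition monoid_algebra_proj :: "('a, 'm) ring_scheme \<Rightarrow> ('a \<Rightarrow>\<^sub>0 int) \<Rightarrow> 'a" where
  "monoid_algebra_proj R c =
     (\<Oplus>\<^bsub>R\<^esub>r\<in>Poly_Mapping.keys c. add_pow R (Poly_Mapping.lookup c r) r)"

definition monoid_algebra_ker :: "('a, 'm) ring_scheme \<Rightarrow> ('a \<Rightarrow>\<^sub>0 int) set" where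
  "monoid_algebra_ker R = a_kernel (monoid_algebra_Z R) R (monoid_algebra_proj R)"

definition ideal_power :: "('a, 'm) ring_scheme \<Rightarrow> 'a set \<Rightarrow> nat \<Rightarrow> 'a set" where
  "ideal_power A I n = I [^]\<^bsub>ideals_set A\<^esub> n"

text \<open>
  The limit of the rings \<open>A/I\<^sup>n\<close>, realised as the compatible families in their product. The
  transition map from \<open>A/I\<^sup>n\<close> to \<open>A/I\<^sup>m\<close>, for \<open>m \<le> n\<close>, sends a coset \<open>X\<close> to the coset \<open>I\<^sup>m + X\<close>.
  The index \<open>n = 0\<close> is included and contributes the zero ring \<open>A/A\<close>.
\<close>

definition adic_completion :: "('a, 'm) ring_scheme \<Rightarrow> 'a set \<Rightarrow> (nat \<Rightarrow> 'a set) ring" where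
  "adic_completion A I =
     (let Q = (\<lambda>n. A Quot ideal_power A I n) in
      \<lparr>carrier = {x. (\<forall>n. x n \<in> carrier (Q n)) \<and>
                     (\<forall>m n. m \<le> n \<longrightarrow> ideal_power A I m <+>\<^bsub>A\<^esub> x n = x m)},
       monoid.mult = (\<lambda>x y n. x n \<otimes>\<^bsub>Q n\<^esub> y n),
       one = (\<lambda>n. \<one>\<^bsub>Q n\<^esub>),
       ring.zero = (\<lambda>n. \<zero>\<^bsub>Q n\<^esub>),
       add = (\<lambda>x y n. x n \<oplus>\<^bsub>Q n\<^esub> y n)\<rparr>)"

text \<open>The limit of the \<open>I\<^sup>i/I\<^sup>n\<close> over \<open>n \<ge> i\<close>, as a subset of the completion.\<close>

definition completed_ideal_power :: "('a, 'm) ring_scheme \<Rightarrow> 'a set \<Rightarrow> nat \<Rightarrow> (nat \<Rightarrow> 'a set) set"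
  where
  "completed_ideal_power A I i =
     {x \<in> carrier (adic_completion A I).
        \<forall>n\<ge>i. x n \<in> (\<lambda>a. ideal_power A I n +>\<^bsub>A\<^esub> a) ` ideal_power A I i}"

definition C_ring :: "('a, 'm) ring_scheme \<Rightarrow> (nat \<Rightarrow> ('a \<Rightarrow>\<^sub>0 int) set) ring" where
  "C_ring R = adic_completion (monoid_algebra_Z R) (monoid_algebra_ker R)"

definition C_ideal :: "('a, 'm) ring_scheme \<Rightarrow> nat \<Rightarrow> (nat \<Rightarrow> ('a \<Rightarrow>\<^sub>0 int) set) set" where
  "C_ideal R = completed_ideal_power (monoid_algebra_Z R) (monoid_algebra_ker R)"

end

theory Submission
  imports Defs "HOL-Algebra.Multiplicative_Group" "HOL-Algebra.Free_Abelian_Groups"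
begin

text \<open>
  The Teichmueller lift \<open>R \<rightarrow> W\<close> is multiplicative, hence extends to a ring homomorphism
  \<open>\<alpha> : \<int>R \<rightarrow> W\<close> lifting \<open>\<pi>\<close>; it is surjective modulo every \<open>p\<^sup>n\<close> and maps \<open>I\<^sup>n\<close> into \<open>p\<^sup>nW\<close>. As \<open>R\<close> is
  perfect, every \<open>c \<in> I\<close> is congruent modulo \<open>p\<close> to \<open>b\<^sup>p\<close> for some \<open>b \<in> I\<close>, so \<open>I \<subseteq> I\<^sup>2 + p\<int>R\<close> and thus
  \<open>I\<^sup>n \<subseteq> I\<^sup>n\<^sup>+\<^sup>1 + p\<^sup>n\<int>R\<close>. Since \<open>p\<close> is not a zero divisor in \<open>W\<close>, induction on \<open>n\<close> gives
  \<open>\<alpha>\<^sup>-\<^sup>1(p\<^sup>nW) = I\<^sup>n\<close>. So \<open>\<int>R/I\<^sup>n \<cong> W/p\<^sup>n\<close> for all \<open>n\<close>, and \<open>C(R) \<cong> W\<close> in the limit, with \<open>p\<^sup>iW\<close> corresponding to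
  the completion of \<open>I\<^sup>i\<close>.
\<close>

section \<open>Topologies defined by ideals, and transport of structure\<close>

text \<open>The Teichmueller representative of \<open>r\<close> is the limit of
  \<open>u^(p^n)\<close>, where \<open>u\<close> lifts the \<open>p^n\<close>-th root of
  \<open>r\<close>: two lifts differ by a multiple of \<open>p\<close>, and each further
  \<open>p\<close>-th power gains another factor \<open>p\<close>, because the inner binomial
  coefficients are divisible by the prime \<open>p\<close>. Two facts carry the computation with
  ideals. First, modulo \<open>p\<close> the \<open>p\<close>-th powers in the monoid algebra are
  closed under subtraction, and they contain every generator because
  \<open>[r] = [r^(1/p)]^p\<close>; injectivity of Frobenius on \<open>R\<close> then brings the
  root of an element of \<open>I\<close> back into \<open>I\<close>. Second, \<open>p\<close> itself
  lies in \<open>I\<close>. Hence \<open>p^n I^2\<close> lies in \<open>I^(n+2)\<close>, which lets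
  the decomposition pass to powers of \<open>I\<close>; and if \<open>a = y + p^n z\<close> with
  \<open>y\<close> in \<open>I^(n+1)\<close> has image in \<open>p^(n+1) W\<close>, cancelling
  \<open>p^n\<close> forces \<open>z\<close> into \<open>I\<close>, so that \<open>p^n z\<close>
  lies in \<open>I^(n+1)\<close> too. The isomorphism is built from \<open>W\<close> to the limit.
  The ring laws, separation and completeness of \<open>C(R)\<close> are not derived from the limit
  but carried over from \<open>W\<close>.\<close>

locale ideal_filtration = cring A for A (structure) +
  fixes \<aa> :: "nat \<Rightarrow> 'a set"
  assumes ideal_seq: "i \<ge> 1 \<Longrightarrow> ideal (\<aa> i) A"
    and decreasing: "i \<ge> 1 \<Longrightarrow> \<aa> (Suc i) \<subseteq> \<aa> i"
begin

lemma antimono_filtration: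
  assumes "1 \<le> i" "i \<le> j"
  shows "\<aa> j \<subseteq> \<aa> i"
  using assms(2) by (induction j rule: dec_induct) (use decreasing assms(1) in \<open>auto intro: order_trans\<close>)

lemma mem_coset_iff:
  assumes "i \<ge> 1" "x \<in> carrier A" "y \<in> carrier A"
  shows "y \<in> \<aa> i +> x \<longleftrightarrow> y \<ominus> x \<in> \<aa> i"
proof -
  interpret ideal "\<aa> i" A by (rule ideal_seq[OF assms(1)])
  show ?thesis using a_rcos_module_minus[OF ring_axioms assms(2,3)] .
qed

lemma coset_subset_carrier:
  "i \<ge> 1 \<Longrightarrow> x \<in> carrier A \<Longrightarrow> \<aa> i +> x \<subseteq> carrier A"
  using ideal_seq[of i] ideal.Icarr by (intro a_r_coset_subset_G) fastforce+

lemma openin_filtration: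
  "openin (ideal_topology A \<aa>) U \<longleftrightarrow> U \<subseteq> carrier A \<and> (\<forall>x\<in>U. \<exists>i\<ge>1. \<aa> i +>\<^bsub>A\<^esub> x \<subseteq> U)"
  by (rule openin_ideal_topology) (rule decreasing)

lemma self_mem_coset: "i \<ge> 1 \<Longrightarrow> x \<in> carrier A \<Longrightarrow> x \<in> \<aa> i +> x"
  using mem_coset_iff[of i x x] additive_subgroup.zero_closed[OF ideal.axioms(1)[OF ideal_seq[of i]]]
    r_right_minus_eq[of x x] by metis

text \<open>Cosets of one ideal are equal or disjoint, so a coset is the basic neighbourhood of each
  of its points.\<close>

lemma openin_coset:
  assumes "i \<ge> 1" "x \<in> carrier A"
  shows "openin (ideal_topology A \<aa>) (\<aa> i +> x)"
  unfolding openin_filtration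
proof (intro conjI ballI)
  show "\<aa> i +> x \<subseteq> carrier A" using coset_subset_carrier assms .
  interpret ideal "\<aa> i" A by (rule ideal_seq[OF assms(1)])
  fix y assume "y \<in> \<aa> i +> x"
  then have "\<aa> i +> y = \<aa> i +> x"
    using a_repr_independence assms(2) a_subgroup by metis
  then show "\<exists>j\<ge>1. \<aa> j +> y \<subseteq> \<aa> i +> x" using assms(1) by auto
qed

lemma topspace_filtration [simp]: "topspace (ideal_topology A \<aa>) = carrier A"
proof
  show "topspace (ideal_topology A \<aa>) \<subseteq> carrier A"
    using openin_filtration openin_topspace by blast
  have "openin (ideal_topology A \<aa>) (carrier A)"
    unfolding openin_filtration using coset_subset_carrier[of 1] by auto
  then show "carrier A \<subseteq> topspace (ideal_topology A \<aa>)" by (rule openin_subset)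
qed

text \<open>If \<open>x - y\<close> lies outside \<open>\<aa> i\<close>, the two cosets of
  \<open>\<aa> i\<close> are disjoint open sets around \<open>x\<close> and \<open>y\<close>;
  conversely an element of every \<open>\<aa> i\<close> lies in every neighbourhood of zero.
  Separation thus becomes an elementwise condition.\<close>

lemma Hausdorff_iff:
  "Hausdorff_space (ideal_topology A \<aa>) \<longleftrightarrow>
     (\<forall>x\<in>carrier A. (\<forall>i\<ge>1. x \<in> \<aa> i) \<longrightarrow> x = \<zero>)"
proof (intro iffI ballI impI)
  fix x assume H: "Hausdorff_space (ideal_topology A \<aa>)" and x: "x \<in> carrier A" "\<forall>i\<ge>1. x \<in> \<aa> i"
  show "x = \<zero>"
  proof (rule ccontr)
    assume "x \<noteq> \<zero>"
    then obtain U V where UV: "openin (ideal_topology A \<aa>) U" "x \<in> V" "\<zero> \<in> U" "disjnt U V"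
      using H x(1) unfolding Hausdorff_space_def by (metis topspace_filtration zero_closed)
    then obtain i where i: "i \<ge> 1" "\<aa> i +> \<zero> \<subseteq> U" unfolding openin_filtration by blast
    have "x \<in> \<aa> i +> \<zero>" using mem_coset_iff[of i \<zero> x] i(1) x by (simp add: minus_eq)
    then show False using UV i by (auto simp: disjnt_iff)
  qed
next
  assume sep: "\<forall>x\<in>carrier A. (\<forall>i\<ge>1. x \<in> \<aa> i) \<longrightarrow> x = \<zero>"
  show "Hausdorff_space (ideal_topology A \<aa>)"
    unfolding Hausdorff_space_def topspace_filtration
  proof (intro allI impI, elim conjE)
    fix x y assume x: "x \<in> carrier A" and y: "y \<in> carrier A" and "x \<noteq> y"
    then have "x \<ominus> y \<noteq> \<zero>" by (simp add: r_right_minus_eq)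
    then obtain i where i: "i \<ge> 1" "x \<ominus> y \<notin> \<aa> i" using sep x y by (metis minus_closed)
    interpret ideal "\<aa> i" A by (rule ideal_seq[OF i(1)])
    have "disjnt (\<aa> i +> x) (\<aa> i +> y)"
    proof (rule ccontr)
      assume "\<not> disjnt (\<aa> i +> x) (\<aa> i +> y)"
      then obtain z where "z \<in> \<aa> i +> x" "z \<in> \<aa> i +> y" by (auto simp: disjnt_iff)
      then have "\<aa> i +> x = \<aa> i +> y" using a_repr_independence x y a_subgroup by metis
      then have "x \<in> \<aa> i +> y" using self_mem_coset[OF i(1) x] by simp
      then show False using i mem_coset_iff x y by blast
    qed
    then show "\<exists>U V. openin (ideal_topology A \<aa>) U \<and> openin (ideal_topology A \<aa>) V
        \<and> x \<in> U \<and> y \<in> V \<and> disjnt U V"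
      using openin_coset[OF i(1) x] openin_coset[OF i(1) y] self_mem_coset[OF i(1) x] self_mem_coset[OF i(1) y]
      by (intro exI[of _ "\<aa> i +> x"] exI[of _ "\<aa> i +> y"]) simp
  qed
qed

text \<open>The cosets \<open>\<aa> i +> l\<close> form a base of neighbourhoods of
  \<open>l\<close>, so convergence needs to be tested on them only.\<close>

lemma limitin_iff:
  assumes "range s \<subseteq> carrier A"
  shows "limitin (ideal_topology A \<aa>) s l sequentially \<longleftrightarrow>
           l \<in> carrier A \<and> (\<forall>i\<ge>1. \<exists>N. \<forall>n\<ge>N. s n \<ominus> l \<in> \<aa> i)"
proof (intro iffI conjI allI impI)
  assume L: "limitin (ideal_topology A \<aa>) s l sequentially"
  then show l: "l \<in> carrier A" using limitin_topspace by fastforce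
  fix i :: nat assume i: "i \<ge> 1"
  have "eventually (\<lambda>n. s n \<in> \<aa> i +> l) sequentially"
    using limitinD[OF L openin_coset[OF i l] self_mem_coset[OF i l]] .
  then show "\<exists>N. \<forall>n\<ge>N. s n \<ominus> l \<in> \<aa> i"
    using mem_coset_iff[OF i l] assms unfolding eventually_sequentially by blast
next
  assume L: "l \<in> carrier A \<and> (\<forall>i\<ge>1. \<exists>N. \<forall>n\<ge>N. s n \<ominus> l \<in> \<aa> i)"
  show "limitin (ideal_topology A \<aa>) s l sequentially"
    unfolding limitin_def topspace_filtration
  proof (intro conjI allI impI; (elim conjE)?)
    show "l \<in> carrier A" using L by blast
    fix U assume "openin (ideal_topology A \<aa>) U" "l \<in> U"
    then obtain i where i: "i \<ge> 1" "\<aa> i +> l \<subseteq> U" unfolding openin_filtration by blast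
    obtain N where "\<forall>n\<ge>N. s n \<ominus> l \<in> \<aa> i" using L i(1) by blast
    then have "\<forall>n\<ge>N. s n \<in> U" using mem_coset_iff[of i l] L i assms by blast
    then show "eventually (\<lambda>n. s n \<in> U) sequentially" unfolding eventually_sequentially by blast
  qed
qed

end

sublocale p_ring \<subseteq> ideal_filtration A \<aa>
  by (intro ideal_filtration.intro ideal_filtration_axioms.intro cring_axioms ideal_seq decreasing)

lemma (in p_ring) separated:
  "x \<in> carrier A \<Longrightarrow> (\<And>i. i \<ge> 1 \<Longrightarrow> x \<in> \<aa> i) \<Longrightarrow> x = \<zero>"
  using Hausdorff Hausdorff_iff by blast

lemma (in p_ring) Cauchy_limit:
  assumes "ideal_Cauchy A \<aa> s"
  obtains l where "l \<in> carrier A" "\<And>i. i \<ge> 1 \<Longrightarrow> \<exists>N. \<forall>n\<ge>N. s n \<ominus> l \<in> \<aa> i"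
proof -
  have "range s \<subseteq> carrier A" using assms unfolding ideal_Cauchy_def by blast
  then show ?thesis
    using complete limitin_iff assms that unfolding ideal_complete_def by metis
qed

section \<open>Transport of the p-ring structure along a ring isomorphism\<close>

text \<open>Frobenius commutes with ring homomorphisms, so Frobenius on \<open>T\<close> is the
  conjugate by \<open>g\<close> of Frobenius on \<open>S\<close>, hence again an
  isomorphism.\<close>

lemma perfect_Fp_algebra_iso:
  assumes T: "cring T" and g: "g \<in> ring_iso T S" and S: "perfect_Fp_algebra p S"
  shows "perfect_Fp_algebra p T"
proof -
  interpret T: cring T by fact
  interpret S: cring S using S unfolding perfect_Fp_algebra_def Fp_algebra_def by blast
  interpret g: ring_hom_cring T S g
    by unfold_locales (use g in \<open>simp add: ring_iso_def\<close>)
  define g' where "g' = inv_into (carrier T) g"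
  have g': "g' \<in> ring_iso S T" unfolding g'_def using ring_iso_set_sym[OF T.ring_axioms g] .
  obtain \<phi> where \<phi>: "\<phi> \<in> ring_hom (ZFact (int p)) S"
    using S unfolding perfect_Fp_algebra_def Fp_algebra_def by blast
  have "g' \<circ> \<phi> \<in> ring_hom (ZFact (int p)) T"
    using ring_hom_trans[OF \<phi>] g' unfolding ring_iso_def by blast
  then have "Fp_algebra p T" unfolding Fp_algebra_def using T by blast
  moreover have "g' \<circ> (\<lambda>x. x [^]\<^bsub>S\<^esub> p) \<circ> g \<in> ring_iso T T"
    using ring_iso_set_trans[OF g ring_iso_set_trans[OF _ g']] S
    unfolding perfect_Fp_algebra_def by (metis comp_assoc)
  \<comment> \<open>The conjugate and the \<open>p\<close>-th power map need to agree on the carrier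
    only.\<close>
  then have "(\<lambda>x. x [^]\<^bsub>T\<^esub> p) \<in> ring_iso T T"
  proof (rule T.ring_iso_restrict)
    fix r assume r: "r \<in> carrier T"
    have "inj_on g (carrier T)" using g unfolding ring_iso_def bij_betw_def by blast
    then have "g' (g (r [^]\<^bsub>T\<^esub> p)) = r [^]\<^bsub>T\<^esub> p"
      unfolding g'_def using r by (intro inv_into_f_f) auto
    then show "(g' \<circ> (\<lambda>x. x [^]\<^bsub>S\<^esub> p) \<circ> g) r = r [^]\<^bsub>T\<^esub> p"
      using r g.ring.hom_nat_pow by simp
  qed
  ultimately show ?thesis unfolding perfect_Fp_algebra_def by blast
qed

lemma (in ring_hom_cring) hom_nat_smult_one:
  "h ([(n::nat)] \<cdot>\<^bsub>R\<^esub> \<one>\<^bsub>R\<^esub>) = [n] \<cdot>\<^bsub>S\<^esub> \<one>\<^bsub>S\<^esub>"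
  by (induction n) simp_all

text \<open>By the criteria above, separation and convergence are statements about membership in the
  ideals, so no homeomorphism has to be built: each clause is pushed to \<open>W\<close> by
  \<open>g\<close> and pulled back by bijectivity.\<close>

lemma strict_p_ring_iso:
  fixes W :: "('b, 'n) ring_scheme" and C :: "('c, 'm) ring_scheme"
  assumes W: "strict_p_ring W p \<aa>" and C: "cring C" and g: "g \<in> ring_iso C W"
    and pre: "\<And>i. i \<ge> 1 \<Longrightarrow> \<cc> i = {x \<in> carrier C. g x \<in> \<aa> i}"
  shows "strict_p_ring C p \<cc>"
proof -
  interpret W: strict_p_ring W p \<aa> by fact
  interpret C: cring C by fact
  interpret g: ring_hom_cring C W g
    by unfold_locales (use g in \<open>simp add: ring_iso_def\<close>)
  have inj: "x = y" if "x \<in> carrier C" "y \<in> carrier C" "g x = g y" for x y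
    using g that unfolding ring_iso_def bij_betw_def inj_on_def by blast
  have surj: "\<exists>x\<in>carrier C. g x = w" if "w \<in> carrier W" for w
    using bij_betw_imp_surj_on[OF ring_iso_memE(5)[OF g]] that by (metis imageE)
  have hom_minus: "g (x \<ominus>\<^bsub>C\<^esub> y) = g x \<ominus>\<^bsub>W\<^esub> g y" if "x \<in> carrier C" "y \<in> carrier C" for x y
    using that by (simp add: a_minus_def)
  \<comment> \<open>The weaker locale makes the topological criteria available for \<open>C\<close>
    before \<open>C\<close> is known to be a p-ring.\<close>
  interpret CF: ideal_filtration C \<cc>
  proof (intro ideal_filtration.intro ideal_filtration_axioms.intro)
    show "cring C" by fact
    show "ideal (\<cc> i) C" if "i \<ge> 1" for i
      using g.ring.ideal_vimage[OF W.ideal_seq[OF that]] pre[OF that] by simp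
    show "\<cc> (Suc i) \<subseteq> \<cc> i" if "i \<ge> 1" for i
      using W.decreasing[OF that] pre[OF that] pre[of "Suc i"] by auto
  qed
  show ?thesis
  proof (intro strict_p_ring.intro p_ring.intro p_ring_axioms.intro strict_p_ring_axioms.intro)
    show "cring C" by fact
    show "ideal (\<cc> i) C" if "i \<ge> 1" for i by (rule CF.ideal_seq[OF that])
    show "\<cc> (Suc i) \<subseteq> \<cc> i" if "i \<ge> 1" for i by (rule CF.decreasing[OF that])
    show "\<cc> i \<cdot>\<^bsub>C\<^esub> \<cc> j \<subseteq> \<cc> (i + j)" if i: "i \<ge> 1" and j: "j \<ge> 1" for i j
    proof
      fix x assume "x \<in> \<cc> i \<cdot>\<^bsub>C\<^esub> \<cc> j"
      then have "x \<in> carrier C \<and> g x \<in> \<aa> i \<cdot>\<^bsub>W\<^esub> \<aa> j"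
        by (induction) (auto simp: pre[OF i] pre[OF j] intro: ideal_prod.intros)
      then show "x \<in> \<cc> (i + j)" using W.ideal_prod_le[OF i j] pre[of "i + j"] i by auto
    qed
    show "Hausdorff_space (ideal_topology C \<cc>)"
      unfolding CF.Hausdorff_iff
    proof (intro ballI impI)
      fix x assume x: "x \<in> carrier C" "\<forall>i\<ge>1. x \<in> \<cc> i"
      have "g x = \<zero>\<^bsub>W\<^esub>" by (rule W.separated) (use x pre in auto)
      then show "x = \<zero>\<^bsub>C\<^esub>" using inj[of x "\<zero>\<^bsub>C\<^esub>"] x by simp
    qed
    show "ideal_complete C \<cc>"
      unfolding ideal_complete_def
    proof (intro allI impI)
      fix s assume s: "ideal_Cauchy C \<cc> s"
      then have s_in: "\<And>n. s n \<in> carrier C" unfolding ideal_Cauchy_def by blast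
      have "ideal_Cauchy W \<aa> (g \<circ> s)"
        unfolding ideal_Cauchy_def
      proof (intro conjI allI impI)
        fix i :: nat assume i: "i \<ge> 1"
        then obtain N where "\<forall>m\<ge>N. \<forall>n\<ge>N. s m \<ominus>\<^bsub>C\<^esub> s n \<in> \<cc> i"
          using s unfolding ideal_Cauchy_def by blast
        then show "\<exists>N. \<forall>m\<ge>N. \<forall>n\<ge>N. (g \<circ> s) m \<ominus>\<^bsub>W\<^esub> (g \<circ> s) n \<in> \<aa> i"
          using s_in unfolding pre[OF i] by (intro exI[of _ N]) (simp add: hom_minus)
      qed (use s_in in auto)
      then obtain l where l: "l \<in> carrier W" "\<And>i. i \<ge> 1 \<Longrightarrow> \<exists>N. \<forall>n\<ge>N. (g \<circ> s) n \<ominus>\<^bsub>W\<^esub> l \<in> \<aa> i"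
        using W.Cauchy_limit by blast
      obtain k where k: "k \<in> carrier C" "g k = l" using surj[OF l(1)] by blast
      have "\<exists>N. \<forall>n\<ge>N. s n \<ominus>\<^bsub>C\<^esub> k \<in> \<cc> i" if "i \<ge> 1" for i
        using l(2)[OF that] k s_in by (simp add: pre[OF that] hom_minus)
      then show "\<exists>l. limitin (ideal_topology C \<cc>) s l sequentially"
        using CF.limitin_iff[of s] s_in k(1) by blast
    qed
    show "perfect_Fp_algebra p (C Quot \<cc> 1)"
    proof -
      interpret I: ideal "\<aa> 1" W by (rule W.ideal_seq) simp
      interpret J: ideal "\<cc> 1" C by (rule CF.ideal_seq) simp
      \<comment> \<open>The composite of \<open>g\<close> with reduction is onto and has kernel
        \<open>\<cc> 1\<close>; the first isomorphism theorem then identifies the two residue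
        rings.\<close>
      define h where "h = (+>\<^bsub>W\<^esub>) (\<aa> 1) \<circ> g"
      have h: "h \<in> ring_hom C (W Quot \<aa> 1)"
        unfolding h_def using ring_hom_trans[OF g.homh I.rcos_ring_hom] .
      interpret Q: ring "W Quot \<aa> 1" by (rule I.quotient_is_ring)
      interpret h: ring_hom_ring C "W Quot \<aa> 1" h by unfold_locales (rule h)
      have surjh: "h ` carrier C = carrier (W Quot \<aa> 1)"
      proof
        show "h ` carrier C \<subseteq> carrier (W Quot \<aa> 1)" using ring_hom_closed[OF h] by blast
        show "carrier (W Quot \<aa> 1) \<subseteq> h ` carrier C"
          using surj unfolding FactRing_def A_RCOSETS_def' h_def by fastforce
      qed
      have ker: "a_kernel C (W Quot \<aa> 1) h = \<cc> 1"
      proof -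
        have "\<aa> 1 +>\<^bsub>W\<^esub> w = \<aa> 1 \<longleftrightarrow> w \<in> \<aa> 1" if "w \<in> carrier W" for w
          using W.a_coset_join1[OF _ that I.a_subgroup] W.a_coset_join2[OF that I.a_subgroup] by blast
        then show ?thesis
          unfolding a_kernel_def' pre[OF order_refl] h_def by (simp add: FactRing_def cong: conj_cong)
      qed
      have "(\<lambda>X. the_elem (h ` X)) \<in> ring_iso (C Quot \<cc> 1) (W Quot \<aa> 1)"
        using h.FactRing_iso_set[OF surjh] ker by simp
      then show ?thesis
        using perfect_Fp_algebra_iso[OF J.quotient_is_cring[OF C]] W.residue_perfect by blast
    qed
    show "\<cc> i = PIdl\<^bsub>C\<^esub> (add_pow C (p ^ i) \<one>\<^bsub>C\<^esub>)" if i: "i \<ge> 1" for i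
    proof -
      \<comment> \<open>Surjectivity lets the cofactor in \<open>W\<close> be written as an image,
        and injectivity then strips \<open>g\<close> from the equation.\<close>
      have "\<cc> i = {x \<in> carrier C. \<exists>w\<in>carrier W. g x = w \<otimes>\<^bsub>W\<^esub> add_pow W (p ^ i) \<one>\<^bsub>W\<^esub>}"
        unfolding pre[OF i] W.ideal_eq_power[OF i] cgenideal_def by auto
      also have "\<dots> = {x \<in> carrier C. \<exists>y\<in>carrier C. g x = g (y \<otimes>\<^bsub>C\<^esub> add_pow C (p ^ i) \<one>\<^bsub>C\<^esub>)}"
        using surj by (auto simp: g.hom_nat_smult_one)
      also have "\<dots> = PIdl\<^bsub>C\<^esub> (add_pow C (p ^ i) \<one>\<^bsub>C\<^esub>)"
      proof -
        have "g x = g (y \<otimes>\<^bsub>C\<^esub> add_pow C (p ^ i) \<one>\<^bsub>C\<^esub>) \<longleftrightarrow> x = y \<otimes>\<^bsub>C\<^esub> add_pow C (p ^ i) \<one>\<^bsub>C\<^esub>"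
          if "x \<in> carrier C" "y \<in> carrier C" for x y
          using inj[of x "y \<otimes>\<^bsub>C\<^esub> add_pow C (p ^ i) \<one>\<^bsub>C\<^esub>"] that by auto
        then have "{x \<in> carrier C. \<exists>y\<in>carrier C. g x = g (y \<otimes>\<^bsub>C\<^esub> add_pow C (p ^ i) \<one>\<^bsub>C\<^esub>)} =
            {x \<in> carrier C. \<exists>y\<in>carrier C. x = y \<otimes>\<^bsub>C\<^esub> add_pow C (p ^ i) \<one>\<^bsub>C\<^esub>}"
          by (simp cong: conj_cong bex_cong)
        then show ?thesis unfolding cgenideal_def by auto
      qed
      finally show ?thesis .
    qed
    show "x = \<zero>\<^bsub>C\<^esub>" if x: "x \<in> carrier C" "add_pow C p \<one>\<^bsub>C\<^esub> \<otimes>\<^bsub>C\<^esub> x = \<zero>\<^bsub>C\<^esub>" for x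
    proof -
      have "add_pow W p \<one>\<^bsub>W\<^esub> \<otimes>\<^bsub>W\<^esub> g x = \<zero>\<^bsub>W\<^esub>"
        using x(1) arg_cong[OF x(2), of g] by (simp add: g.hom_nat_smult_one)
      then have "g x = \<zero>\<^bsub>W\<^esub>" using W.p_not_zero_divisor x(1) by simp
      then show ?thesis using inj[of x "\<zero>\<^bsub>C\<^esub>"] x(1) by simp
    qed
  qed
qed

section \<open>The binomial theorem\<close>

context cring
begin

text \<open>Turns a multiple into a product with the ring element \<open>n\<close> times one, so
  that divisibility by \<open>p\<close> can be handled by the ring laws.\<close>

lemma nat_smult_eq_mult: "x \<in> carrier R \<Longrightarrow> [(n::nat)] \<cdot> x = [n] \<cdot> \<one> \<otimes> x"
  by (simp add: add_pow_ldistr)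

lemma nat_smult_one_mult: "[(m * n :: nat)] \<cdot> \<one> = [m] \<cdot> \<one> \<otimes> [n] \<cdot> \<one>"
  by (simp add: nat_smult_eq_mult[symmetric] add.nat_pow_pow mult.commute)

lemma binomial_theorem:
  assumes x: "x \<in> carrier R" and y: "y \<in> carrier R"
  shows "(x \<oplus> y) [^] (n::nat) = (\<Oplus>k\<in>{..n}. [(n choose k)] \<cdot> (x [^] k \<otimes> y [^] (n - k)))"
proof (induction n)
  case (Suc n)
  \<comment> \<open>The exponent \<open>m\<close> is kept apart from the index \<open>k\<close> of
    the coefficient: multiplication by \<open>x\<close> raises the exponent but keeps the
    coefficient, and Pascal's rule later joins \<open>t (Suc k) k\<close> with
    \<open>t (Suc k) (Suc k)\<close>.\<close>
  define t where "t m k = [(n choose k)] \<cdot> (x [^] m \<otimes> y [^] (Suc n - m))" for m k :: nat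
  have t: "t m k \<in> carrier R" for m k unfolding t_def using x y by simp
  have xs: "x \<otimes> (\<Oplus>k\<in>{..n}. [(n choose k)] \<cdot> (x [^] k \<otimes> y [^] (n - k))) = (\<Oplus>k\<in>{..n}. t (Suc k) k)"
  proof -
    have "x \<otimes> (\<Oplus>k\<in>{..n}. [(n choose k)] \<cdot> (x [^] k \<otimes> y [^] (n - k)))
        = (\<Oplus>k\<in>{..n}. x \<otimes> ([(n choose k)] \<cdot> (x [^] k \<otimes> y [^] (n - k))))"
      by (rule finsum_rdistr) (use x y in auto)
    also have "\<dots> = (\<Oplus>k\<in>{..n}. t (Suc k) k)"
      by (rule finsum_cong')
        (use x y in \<open>auto simp: t_def add_pow_rdistr m_ac\<close>)
    finally show ?thesis .
  qed
  have ys: "y \<otimes> (\<Oplus>k\<in>{..n}. [(n choose k)] \<cdot> (x [^] k \<otimes> y [^] (n - k))) = (\<Oplus>k\<in>{..Suc n}. t k k)"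
  proof -
    have "y \<otimes> (\<Oplus>k\<in>{..n}. [(n choose k)] \<cdot> (x [^] k \<otimes> y [^] (n - k)))
        = (\<Oplus>k\<in>{..n}. y \<otimes> ([(n choose k)] \<cdot> (x [^] k \<otimes> y [^] (n - k))))"
      by (rule finsum_rdistr) (use x y in auto)
    also have "\<dots> = (\<Oplus>k\<in>{..n}. t k k)"
      by (rule finsum_cong')
        (use x y in \<open>auto simp: t_def add_pow_rdistr m_ac Suc_diff_le\<close>)
    \<comment> \<open>The added term vanishes, its coefficient being
      \<open>n choose Suc n\<close>.\<close>
    also have "\<dots> = (\<Oplus>k\<in>{..Suc n}. t k k)"
      using t x y by (simp add: finsum_Suc t_def[of "Suc n" "Suc n"] binomial_eq_0)
    finally show ?thesis .
  qed
  have "(x \<oplus> y) [^] Suc n = (\<Oplus>k\<in>{..n}. t (Suc k) k) \<oplus> (\<Oplus>k\<in>{..Suc n}. t k k)"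
    unfolding xs[symmetric] ys[symmetric] using x y Suc.IH by (simp add: m_comm l_distr)
  also have "(\<Oplus>k\<in>{..Suc n}. t k k) = (\<Oplus>k\<in>{..n}. t (Suc k) (Suc k)) \<oplus> t 0 0"
    by (rule finsum_Suc2) (use t in auto)
  also have "(\<Oplus>k\<in>{..n}. t (Suc k) k) \<oplus> ((\<Oplus>k\<in>{..n}. t (Suc k) (Suc k)) \<oplus> t 0 0) =
      (\<Oplus>k\<in>{..n}. t (Suc k) k \<oplus> t (Suc k) (Suc k)) \<oplus> t 0 0"
    using t by (simp add: finsum_addf a_assoc)
  also have "\<dots> = (\<Oplus>k\<in>{..n}. [(Suc n choose Suc k)] \<cdot> (x [^] Suc k \<otimes> y [^] (Suc n - Suc k))) \<oplus>
      [(Suc n choose 0)] \<cdot> (x [^] (0::nat) \<otimes> y [^] (Suc n - 0))"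
  proof (rule arg_cong2[where f = "(\<oplus>)"])
    show "(\<Oplus>k\<in>{..n}. t (Suc k) k \<oplus> t (Suc k) (Suc k)) =
        (\<Oplus>k\<in>{..n}. [(Suc n choose Suc k)] \<cdot> (x [^] Suc k \<otimes> y [^] (Suc n - Suc k)))"
      by (rule finsum_cong')
        (use x y in \<open>auto simp: t_def add.nat_pow_mult simp del: nat_pow_Suc\<close>)
  qed (simp add: t_def)
  also have "\<dots> = (\<Oplus>k\<in>{..Suc n}. [(Suc n choose k)] \<cdot> (x [^] k \<otimes> y [^] (Suc n - k)))"
    by (rule finsum_Suc2[symmetric]) (use x y in auto)
  finally show ?case .
qed simp

text \<open>The inner binomial coefficients are divisible by \<open>p\<close>. The factor
  \<open>y\<close> is kept in the error term because \<open>prime_power_congr\<close> puts there a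
  multiple of \<open>p ^ n\<close>, which raises the error to a multiple of
  \<open>p ^ Suc n\<close>.\<close>

lemma add_power_prime:
  assumes p: "Factorial_Ring.prime (p::nat)" and x: "x \<in> carrier R" and y: "y \<in> carrier R"
  obtains z where "z \<in> carrier R" "(x \<oplus> y) [^] p = x [^] p \<oplus> y [^] p \<oplus> [p] \<cdot> \<one> \<otimes> (y \<otimes> z)"
proof -
  define c where "c k = [(p choose k)] \<cdot> (x [^] k \<otimes> y [^] (p - k))" for k
  \<comment> \<open>The term \<open>c k\<close> with one factor \<open>p\<close> and one factor
    \<open>y\<close> removed.\<close>
  define d where "d k = [((p choose k) div p)] \<cdot> (x [^] k \<otimes> y [^] (p - Suc k))" for k
  have c: "c k \<in> carrier R" and d: "d k \<in> carrier R" for k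
    unfolding c_def d_def using x y by simp_all
  \<comment> \<open>With \<open>n = p - 2\<close>, the indices \<open>Suc k\<close> for
    \<open>k \<le> n\<close> are exactly the inner ones, from 1 to \<open>p - 1\<close>.\<close>
  obtain n where n: "p = Suc (Suc n)"
    using prime_ge_2_nat[OF p] by (metis Suc_diff_Suc add_2_eq_Suc le_Suc_ex)
  have cd: "c (Suc k) = [p] \<cdot> \<one> \<otimes> (y \<otimes> d (Suc k))" if "k \<le> n" for k
  proof -
    have "p dvd (p choose Suc k)" by (rule dvd_choose_prime) (use that n p in auto)
    then have "c (Suc k) = [p] \<cdot> ([((p choose Suc k) div p)] \<cdot> (x [^] Suc k \<otimes> y [^] (p - Suc k)))"
      unfolding c_def using x y by (subst add.nat_pow_pow) (auto simp: mult.commute)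
    also have "p - Suc k = Suc (p - Suc (Suc k))" using that n by simp
    finally show ?thesis
      unfolding d_def using x y
      by (subst nat_smult_eq_mult[symmetric])
        (auto simp: add_pow_rdistr m_ac)
  qed
  define z where "z = (\<Oplus>k\<in>{..n}. d (Suc k))"
  have z: "z \<in> carrier R" unfolding z_def using d by (simp add: finsum_closed)
  have "(x \<oplus> y) [^] p = (\<Oplus>k\<in>{..Suc (Suc n)}. c k)"
    unfolding c_def n[symmetric] by (rule binomial_theorem[OF x y])
  also have "\<dots> = c p \<oplus> ((\<Oplus>k\<in>{..n}. c (Suc k)) \<oplus> c 0)"
    using c n by (subst finsum_Suc, simp, subst finsum_Suc2) auto
  also have "(\<Oplus>k\<in>{..n}. c (Suc k)) = (\<Oplus>k\<in>{..n}. [p] \<cdot> \<one> \<otimes> (y \<otimes> d (Suc k)))"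
    by (rule finsum_cong') (use cd d y in auto)
  also have "\<dots> = [p] \<cdot> \<one> \<otimes> (y \<otimes> z)"
    unfolding z_def using d y by (simp add: finsum_rdistr)
  also have "c p = x [^] p" unfolding c_def using x by simp
  also have "c 0 = y [^] p" unfolding c_def using y by simp
  finally have "(x \<oplus> y) [^] p = x [^] p \<oplus> y [^] p \<oplus> [p] \<cdot> \<one> \<otimes> (y \<otimes> z)"
    using x y z by (simp add: a_ac)
  then show ?thesis using that z by blast
qed

text \<open>With \<open>x = y + d\<close> and \<open>d = p^n z\<close>, the cross terms carry
  \<open>p d\<close>, and \<open>d^p\<close> contains \<open>d^2\<close>, hence
  \<open>p^(2n)\<close>; the hypothesis \<open>n \<ge> 1\<close> gives
  \<open>2n \<ge> n + 1\<close>.\<close>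

lemma prime_power_congr:
  assumes p: "Factorial_Ring.prime (p::nat)" and n: "n \<ge> 1"
    and x: "x \<in> carrier R" and y: "y \<in> carrier R" and z: "z \<in> carrier R"
    and xy: "x \<ominus> y = [(p ^ n)] \<cdot> \<one> \<otimes> z"
  shows "\<exists>w\<in>carrier R. x [^] p \<ominus> y [^] p = [(p ^ Suc n)] \<cdot> \<one> \<otimes> w"
proof -
  define d where "d = [(p ^ n)] \<cdot> \<one> \<otimes> z"
  have d: "d \<in> carrier R" unfolding d_def using z by simp
  have x_eq: "x = y \<oplus> d"
  proof -
    have "y \<oplus> (x \<ominus> y) = x" using x y by (simp add: minus_eq a_lcomm r_neg)
    then show ?thesis unfolding d_def xy ..
  qed
  obtain t where t: "t \<in> carrier R" "x [^] p = y [^] p \<oplus> d [^] p \<oplus> [p] \<cdot> \<one> \<otimes> (d \<otimes> t)"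
    using add_power_prime[OF p y d] unfolding x_eq by blast
  obtain k where k: "p = Suc (Suc k)"
    using prime_ge_2_nat[OF p] by (metis Suc_diff_Suc add_2_eq_Suc le_Suc_ex)
  obtain m where m: "n = Suc m" using n by (cases n) auto
  \<comment> \<open>The first summand is \<open>d^p\<close> divided by \<open>p^(n+1)\<close>, using
    \<open>2n = (n + 1) + m\<close> with \<open>m = n - 1\<close> and \<open>p = k + 2\<close>; the
    second comes from the cross terms.\<close>
  define w where "w = [(p ^ m)] \<cdot> \<one> \<otimes> (z \<otimes> z \<otimes> d [^] k) \<oplus> z \<otimes> t"
  have w: "w \<in> carrier R" unfolding w_def using z d t(1) by simp
  have "d [^] p = d \<otimes> d \<otimes> d [^] k"
    unfolding k using d by (simp add: m_ac)
  also have "\<dots> = ([(p ^ n)] \<cdot> \<one> \<otimes> [(p ^ n)] \<cdot> \<one>) \<otimes> (z \<otimes> z \<otimes> d [^] k)"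
    using d z by (simp add: d_def m_ac)
  also have "[(p ^ n)] \<cdot> \<one> \<otimes> [(p ^ n)] \<cdot> \<one> = [(p ^ Suc n)] \<cdot> \<one> \<otimes> [(p ^ m)] \<cdot> \<one>"
    unfolding nat_smult_one_mult[symmetric] m by (simp add: mult_ac)
  finally have dp: "d [^] p = [(p ^ Suc n)] \<cdot> \<one> \<otimes> ([(p ^ m)] \<cdot> \<one> \<otimes> (z \<otimes> z \<otimes> d [^] k))"
    using z d by (simp add: m_assoc)
  have "[p] \<cdot> \<one> \<otimes> (d \<otimes> t) = ([p] \<cdot> \<one> \<otimes> [(p ^ n)] \<cdot> \<one>) \<otimes> (z \<otimes> t)"
    unfolding d_def using z t(1) by (simp add: m_assoc)
  also have "[p] \<cdot> \<one> \<otimes> [(p ^ n)] \<cdot> \<one> = [(p ^ Suc n)] \<cdot> \<one>"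
    unfolding nat_smult_one_mult[symmetric] by simp
  finally have "x [^] p = y [^] p \<oplus> [(p ^ Suc n)] \<cdot> \<one> \<otimes> w"
    unfolding w_def t(2) dp using z d t(1) y by (simp add: r_distr a_assoc del: power_Suc)
  then have "x [^] p \<ominus> y [^] p = [(p ^ Suc n)] \<cdot> \<one> \<otimes> w"
    using y w by (simp add: minus_eq a_ac r_neg1 r_neg2 del: power_Suc)
  then show ?thesis using w by blast
qed

end

section \<open>Monoid algebras\<close>

lemma frag_cmul_diff_distrib2: "frag_cmul k (a - b) = frag_cmul k a - frag_cmul k b"
  by (rule poly_mapping_eqI) (simp add: lookup_minus right_diff_distrib)

lemma frag_extend_fun_diff:
  "frag_extend (\<lambda>r. f r - g r) c = frag_extend f c - frag_extend g c"
  unfolding frag_extend_def by (simp add: frag_cmul_diff_distrib2 sum_subtractf)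

lemma carrier_monoid_algebra_Z: "carrier (monoid_algebra_Z M) = {c. Poly_Mapping.keys c \<subseteq> carrier M}"
  by (simp add: monoid_algebra_Z_def)

lemma monoid_algebra_Z_simps [simp]:
  "a \<otimes>\<^bsub>monoid_algebra_Z M\<^esub> b = frag_extend (\<lambda>r. frag_extend (\<lambda>s. frag_of (r \<otimes>\<^bsub>M\<^esub> s)) b) a"
  "\<one>\<^bsub>monoid_algebra_Z M\<^esub> = frag_of \<one>\<^bsub>M\<^esub>"
  "\<zero>\<^bsub>monoid_algebra_Z M\<^esub> = 0"
  "a \<oplus>\<^bsub>monoid_algebra_Z M\<^esub> b = a + b"
  by (simp_all add: monoid_algebra_Z_def)

lemma monoid_algebra_mult_of:
  "frag_of r \<otimes>\<^bsub>monoid_algebra_Z M\<^esub> frag_of s = frag_of (r \<otimes>\<^bsub>M\<^esub> s)"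
  by simp

lemma monoid_algebra_Z_diff_mult:
  "(a - a') \<otimes>\<^bsub>monoid_algebra_Z M\<^esub> b =
     (a \<otimes>\<^bsub>monoid_algebra_Z M\<^esub> b) - (a' \<otimes>\<^bsub>monoid_algebra_Z M\<^esub> b)"
  by (simp add: frag_extend_diff)

lemma monoid_algebra_Z_mult_diff:
  "a \<otimes>\<^bsub>monoid_algebra_Z M\<^esub> (b - b') =
     (a \<otimes>\<^bsub>monoid_algebra_Z M\<^esub> b) - (a \<otimes>\<^bsub>monoid_algebra_Z M\<^esub> b')"
  by (simp add: frag_extend_diff frag_extend_fun_diff)

text \<open>The product is the biadditive extension of the monoid law, so its laws reduce to
  generators. The induction rule for free abelian groups closes under differences, which is why
  distributivity was prepared for \<open>-\<close>.\<close>

lemma monoid_algebra_Z_cring: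
  assumes "comm_monoid M"
  shows "cring (monoid_algebra_Z M)"
proof -
  interpret M: comm_monoid M by fact
  let ?Z = "monoid_algebra_Z M"
  note mult_diff = monoid_algebra_Z_diff_mult and diff_mult = monoid_algebra_Z_mult_diff
  have closed: "Poly_Mapping.keys (a \<otimes>\<^bsub>?Z\<^esub> b) \<subseteq> carrier M"
    if a: "Poly_Mapping.keys a \<subseteq> carrier M" and b: "Poly_Mapping.keys b \<subseteq> carrier M" for a b
  proof
    fix k assume "k \<in> Poly_Mapping.keys (a \<otimes>\<^bsub>?Z\<^esub> b)"
    then obtain r where r: "r \<in> Poly_Mapping.keys a"
      "k \<in> Poly_Mapping.keys (frag_extend (\<lambda>s. frag_of (r \<otimes>\<^bsub>M\<^esub> s)) b)"
      using keys_frag_extend by fastforce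
    then obtain s where "s \<in> Poly_Mapping.keys b" "k = r \<otimes>\<^bsub>M\<^esub> s"
      using keys_frag_extend by fastforce
    then show "k \<in> carrier M" using r(1) a b by blast
  qed
  have comm: "a \<otimes>\<^bsub>?Z\<^esub> b = b \<otimes>\<^bsub>?Z\<^esub> a"
    if a: "Poly_Mapping.keys a \<subseteq> carrier M" and b: "Poly_Mapping.keys b \<subseteq> carrier M" for a b
    using a
  proof (induction a rule: frag_induction)
    case zero
    show ?case by (simp add: frag_extend_eq_0)
  next
    case (one r)
    show ?case using one b by (auto intro!: frag_extend_eq simp: M.m_comm subset_iff)
  next
    case (diff a a')
    then show ?case by (simp only: mult_diff diff_mult)
  qed
  have assoc: "(a \<otimes>\<^bsub>?Z\<^esub> b) \<otimes>\<^bsub>?Z\<^esub> c = a \<otimes>\<^bsub>?Z\<^esub> (b \<otimes>\<^bsub>?Z\<^esub> c)"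
    if a: "Poly_Mapping.keys a \<subseteq> carrier M" and b: "Poly_Mapping.keys b \<subseteq> carrier M"
      and c: "Poly_Mapping.keys c \<subseteq> carrier M" for a b c
    using a
  proof (induction a rule: frag_induction)
    case (one r)
    show ?case using b
    proof (induction b rule: frag_induction)
      case (one s)
      have "frag_extend (\<lambda>t. frag_of (r \<otimes>\<^bsub>M\<^esub> t)) (frag_extend (frag_of \<circ> (\<lambda>t. s \<otimes>\<^bsub>M\<^esub> t)) c) =
        frag_extend (\<lambda>t. frag_of (r \<otimes>\<^bsub>M\<^esub> s \<otimes>\<^bsub>M\<^esub> t)) c"
        unfolding frag_extend_compose
        using one \<open>r \<in> carrier M\<close> c by (auto intro!: frag_extend_eq simp: M.m_assoc subset_iff)
      then show ?case by (simp add: o_def)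
    next
      case (diff b b')
      then show ?case by (simp only: mult_diff diff_mult)
    qed simp
  next
    case (diff a a')
    then show ?case by (simp only: mult_diff diff_mult)
  qed simp
  show ?thesis
  proof (rule cringI)
    show "abelian_group ?Z"
    proof (rule abelian_groupI)
      fix x assume "x \<in> carrier ?Z"
      then show "\<exists>y\<in>carrier ?Z. y \<oplus>\<^bsub>?Z\<^esub> x = \<zero>\<^bsub>?Z\<^esub>"
        by (intro bexI[of _ "- x"]) (auto simp: carrier_monoid_algebra_Z)
    next
      fix x y assume "x \<in> carrier ?Z" "y \<in> carrier ?Z"
      then show "x \<oplus>\<^bsub>?Z\<^esub> y \<in> carrier ?Z"
        using keys_add[of x y] by (auto simp: carrier_monoid_algebra_Z)
    qed (auto simp: carrier_monoid_algebra_Z add_ac)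
    have one: "\<one>\<^bsub>?Z\<^esub> \<otimes>\<^bsub>?Z\<^esub> a = a" if "Poly_Mapping.keys a \<subseteq> carrier M" for a
      using that by (induction a rule: frag_induction) (auto simp: frag_extend_diff)
    show "comm_monoid ?Z"
    proof (rule comm_monoidI)
      show "\<one>\<^bsub>?Z\<^esub> \<in> carrier ?Z" by (simp add: carrier_monoid_algebra_Z)
      fix x y z assume xyz: "x \<in> carrier ?Z" "y \<in> carrier ?Z" "z \<in> carrier ?Z"
      then show "x \<otimes>\<^bsub>?Z\<^esub> y \<otimes>\<^bsub>?Z\<^esub> z = x \<otimes>\<^bsub>?Z\<^esub> (y \<otimes>\<^bsub>?Z\<^esub> z)"
        unfolding carrier_monoid_algebra_Z mem_Collect_eq by (rule assoc)
    next
      fix x y assume "x \<in> carrier ?Z" "y \<in> carrier ?Z"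
      then show "x \<otimes>\<^bsub>?Z\<^esub> y = y \<otimes>\<^bsub>?Z\<^esub> x" "x \<otimes>\<^bsub>?Z\<^esub> y \<in> carrier ?Z"
        unfolding carrier_monoid_algebra_Z mem_Collect_eq by (rule comm, rule closed)
    next
      fix x assume "x \<in> carrier ?Z"
      then show "\<one>\<^bsub>?Z\<^esub> \<otimes>\<^bsub>?Z\<^esub> x = x"
        unfolding carrier_monoid_algebra_Z mem_Collect_eq by (rule one)
    qed
    show "(x \<oplus>\<^bsub>?Z\<^esub> y) \<otimes>\<^bsub>?Z\<^esub> z = x \<otimes>\<^bsub>?Z\<^esub> z \<oplus>\<^bsub>?Z\<^esub> y \<otimes>\<^bsub>?Z\<^esub> z" for x y z
      by (simp add: frag_extend_add)
  qed
qed

lemma monoid_algebra_Z_minus: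
  assumes "comm_monoid M" and x: "x \<in> carrier (monoid_algebra_Z M)" and y: "y \<in> carrier (monoid_algebra_Z M)"
  shows "x \<ominus>\<^bsub>monoid_algebra_Z M\<^esub> y = x - y"
proof -
  interpret cring "monoid_algebra_Z M" using monoid_algebra_Z_cring[OF assms(1)] .
  have "- y \<in> carrier (monoid_algebra_Z M)" using y by (simp add: carrier_monoid_algebra_Z)
  then have "\<ominus>\<^bsub>monoid_algebra_Z M\<^esub> y = - y" by (rule minus_equality[rotated 2]) (use y in auto)
  then show ?thesis by (simp add: a_minus_def)
qed

section \<open>The universal property of the monoid algebra\<close>

text \<open>The additive extension of \<open>\<tau>\<close> from generators. The identity gives the
  projection to \<open>R\<close> and the Teichmueller map gives the map to \<open>W\<close>, so one
  lemma makes both into ring homomorphisms.\<close>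

definition monoid_algebra_lift ::
  "('b, 'n) ring_scheme \<Rightarrow> ('a \<Rightarrow> 'b) \<Rightarrow> ('a \<Rightarrow>\<^sub>0 int) \<Rightarrow> 'b" where
  "monoid_algebra_lift S \<tau> c =
     (\<Oplus>\<^bsub>S\<^esub>r\<in>Poly_Mapping.keys c. add_pow S (Poly_Mapping.lookup c r) (\<tau> r))"

lemma monoid_algebra_proj_eq_lift: "monoid_algebra_proj R = monoid_algebra_lift R (\<lambda>r. r)"
  by (simp add: monoid_algebra_proj_def monoid_algebra_lift_def fun_eq_iff)

text \<open>Cancellation can make the support of a sum smaller than the union of the supports;
  additivity therefore needs a common index set, on which the extra terms are zero.\<close>

lemma (in abelian_group) monoid_algebra_lift_superset:
  assumes B: "finite B" "Poly_Mapping.keys c \<subseteq> B" and \<tau>: "\<And>r. r \<in> B \<Longrightarrow> \<tau> r \<in> carrier G"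
  shows "monoid_algebra_lift G \<tau> c = (\<Oplus>r\<in>B. [(Poly_Mapping.lookup c r)] \<cdot> \<tau> r)"
  unfolding monoid_algebra_lift_def
proof (rule add.finprod_mono_neutral_cong_left)
  show "[(Poly_Mapping.lookup c r)] \<cdot> \<tau> r = \<zero>" if "r \<in> B - Poly_Mapping.keys c" for r
    using that \<tau> by (simp add: in_keys_iff add_pow_int_ge)
qed (use B \<tau> in auto)

lemma (in abelian_group) monoid_algebra_lift_add:
  assumes \<tau>: "\<And>r. r \<in> S \<Longrightarrow> \<tau> r \<in> carrier G"
    and a: "Poly_Mapping.keys a \<subseteq> S" and b: "Poly_Mapping.keys b \<subseteq> S"
  shows "monoid_algebra_lift G \<tau> (a + b) = monoid_algebra_lift G \<tau> a \<oplus> monoid_algebra_lift G \<tau> b"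
proof -
  define B where "B = Poly_Mapping.keys a \<union> Poly_Mapping.keys b"
  have B: "finite B" "B \<subseteq> S" "Poly_Mapping.keys a \<subseteq> B" "Poly_Mapping.keys b \<subseteq> B" "Poly_Mapping.keys (a + b) \<subseteq> B"
    unfolding B_def using a b keys_add[of a b] by auto
  have \<tau>B: "\<tau> r \<in> carrier G" if "r \<in> B" for r using \<tau> B(2) that by blast
  have "(\<Oplus>r\<in>B. [(Poly_Mapping.lookup (a + b) r)] \<cdot> \<tau> r) =
      (\<Oplus>r\<in>B. [(Poly_Mapping.lookup a r)] \<cdot> \<tau> r \<oplus> [(Poly_Mapping.lookup b r)] \<cdot> \<tau> r)"
    by (rule add.finprod_cong') (use \<tau>B in \<open>auto simp: lookup_add add.int_pow_mult\<close>)
  also have "\<dots> = (\<Oplus>r\<in>B. [(Poly_Mapping.lookup a r)] \<cdot> \<tau> r) \<oplus> (\<Oplus>r\<in>B. [(Poly_Mapping.lookup b r)] \<cdot> \<tau> r)"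
    by (rule finsum_addf) (use \<tau>B in auto)
  finally show ?thesis
    using monoid_algebra_lift_superset[OF B(1) B(3) \<tau>B] monoid_algebra_lift_superset[OF B(1) B(4) \<tau>B]
      monoid_algebra_lift_superset[OF B(1) B(5) \<tau>B] by simp
qed

lemma (in abelian_group) monoid_algebra_lift_of:
  "\<tau> r \<in> carrier G \<Longrightarrow> monoid_algebra_lift G \<tau> (frag_of r) = \<tau> r"
  using monoid_algebra_lift_superset[of "{r}" "frag_of r" \<tau>] by (simp add: add.finprod_singleton)

text \<open>Once the lift respects differences, multiplicativity follows by induction in each factor
  from generators, where it is that of \<open>\<tau>\<close>.\<close>

lemma monoid_algebra_lift_hom:
  assumes M: "comm_monoid M" and S: "cring S" and \<tau>: "\<tau> \<in> hom M S" and \<tau>1: "\<tau> \<one>\<^bsub>M\<^esub> = \<one>\<^bsub>S\<^esub>"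
  shows "monoid_algebra_lift S \<tau> \<in> ring_hom (monoid_algebra_Z M) S"
proof -
  interpret M: comm_monoid M by fact
  interpret S: cring S by fact
  let ?Z = "monoid_algebra_Z M" and ?h = "monoid_algebra_lift S \<tau>"
  interpret Z: cring ?Z using monoid_algebra_Z_cring[OF M] .
  have \<tau>c: "\<tau> r \<in> carrier S" if "r \<in> carrier M" for r using \<tau> that by (auto simp: hom_def)
  have closed: "?h a \<in> carrier S" if "a \<in> carrier ?Z" for a
    unfolding monoid_algebra_lift_def using that \<tau>c
    by (auto simp: carrier_monoid_algebra_Z intro!: S.finsum_closed)
  have add: "?h (a + b) = ?h a \<oplus>\<^bsub>S\<^esub> ?h b" if "a \<in> carrier ?Z" "b \<in> carrier ?Z" for a b
    using S.monoid_algebra_lift_add[of "carrier M" \<tau> a b] \<tau>c that by (simp add: carrier_monoid_algebra_Z)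
  have h_of: "?h (frag_of r) = \<tau> r" if "r \<in> carrier M" for r
    using S.monoid_algebra_lift_of[of \<tau> r] \<tau>c that by simp
  have h_zero: "?h 0 = \<zero>\<^bsub>S\<^esub>" by (simp add: monoid_algebra_lift_def)
  have diff_closed: "a - b \<in> carrier ?Z" if "a \<in> carrier ?Z" "b \<in> carrier ?Z" for a b
    using that monoid_algebra_Z_minus[OF M that] Z.minus_closed by metis
  have h_diff: "?h (a - b) = ?h a \<ominus>\<^bsub>S\<^esub> ?h b" if a: "a \<in> carrier ?Z" and b: "b \<in> carrier ?Z" for a b
  proof -
    have "?h a = ?h (a - b) \<oplus>\<^bsub>S\<^esub> ?h b" using add[OF diff_closed[OF a b] b] by simp
    then show ?thesis using closed[OF b] closed[OF diff_closed[OF a b]]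
      by (simp add: S.minus_eq S.a_assoc S.r_neg)
  qed
  have mult: "?h (a \<otimes>\<^bsub>?Z\<^esub> b) = ?h a \<otimes>\<^bsub>S\<^esub> ?h b"
    if "a \<in> carrier ?Z" and "b \<in> carrier ?Z" for a b
    using that unfolding carrier_monoid_algebra_Z mem_Collect_eq
  proof (induction a rule: free_Abelian_group_induct[consumes 1, case_names zero diff of])
    case zero
    then show ?case using closed[of b] by (simp add: carrier_monoid_algebra_Z h_zero)
  next
    case (diff x y)
    then have "x \<in> carrier ?Z" "y \<in> carrier ?Z" "b \<in> carrier ?Z"
      by (simp_all add: carrier_monoid_algebra_Z)
    then show ?case
      using diff.IH[OF diff.prems] closed Z.m_closed
      by (simp only: monoid_algebra_Z_diff_mult h_diff Z.m_closed S.minus_eq S.l_distr S.l_minus S.a_inv_closed)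
  next
    case (of r)
    note r = of(1)
    from of(2) show ?case
    proof (induction b rule: free_Abelian_group_induct[consumes 1, case_names zero diff of])
      case zero
      then show ?case using \<tau>c[OF r] h_of[OF r] by (simp add: h_zero)
    next
      case (diff x y)
      then have "x \<in> carrier ?Z" "y \<in> carrier ?Z" "frag_of r \<in> carrier ?Z"
        using r by (simp_all add: carrier_monoid_algebra_Z)
      then show ?case
        using diff.IH closed Z.m_closed
        by (simp only: monoid_algebra_Z_mult_diff h_diff Z.m_closed S.minus_eq S.r_distr S.r_minus S.a_inv_closed)
    next
      case (of s)
      then show ?case
        using r \<tau> by (simp only: monoid_algebra_mult_of h_of M.m_closed hom_mult)
    qed
  qed
  show ?thesis
    by (rule ring_hom_memI) (use closed mult add h_of \<tau>1 in \<open>simp_all del: monoid_algebra_Z_simps(1)\<close>)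
qed

declare monoid_algebra_Z_simps [simp del]

section \<open>Adic completions\<close>

context cring
begin

lemma ideal_power_0 [simp]: "ideal_power R I 0 = carrier R"
  unfolding ideal_power_def ideals_set_def by (simp add: nat_pow_def)

lemma ideal_power_Suc: "ideal_power R I (Suc n) = ideal_power R I n \<cdot> I"
  unfolding ideal_power_def ideals_set_def by (simp add: nat_pow_def)

lemma ideal_power_ideal: "ideal I R \<Longrightarrow> ideal (ideal_power R I n) R"
  by (induction n) (simp_all add: oneideal ideal_power_Suc ideal_prod_is_ideal)

lemma ideal_power_Suc_subset: "ideal I R \<Longrightarrow> ideal_power R I (Suc n) \<subseteq> ideal_power R I n"
  using ideal_prod_inter[OF ideal_power_ideal] unfolding ideal_power_Suc by blast

lemma ideal_power_antimono: "ideal I R \<Longrightarrow> m \<le> n \<Longrightarrow> ideal_power R I n \<subseteq> ideal_power R I m"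
  using lift_Suc_antimono_le[of "ideal_power R I" m n] ideal_power_Suc_subset by blast

lemma ideal_power_1 [simp]: "ideal I R \<Longrightarrow> ideal_power R I (Suc 0) = I"
  using ideal_prod_one ideal_prod_commute[OF _ oneideal] by (simp add: ideal_power_Suc)

text \<open>Computes the transition maps of the limit: a coset of \<open>K\<close> goes to the coset
  of \<open>J\<close> with the same representative, since \<open>J + K = J\<close>.\<close>

lemma add_subideal_coset:
  assumes J: "ideal J R" and K: "ideal K R" "K \<subseteq> J" and a: "a \<in> carrier R"
  shows "J <+> (K +> a) = J +> a"
proof -
  interpret J: ideal J R by fact
  interpret K: ideal K R by fact
  have "J <+> K = J"
  proof
    show "J <+> K \<subseteq> J" using K(2) unfolding set_add_def' by auto
    show "J \<subseteq> J <+> K"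
    proof
      fix j assume j: "j \<in> J"
      then have "j = j \<oplus> \<zero>" using J.Icarr by simp
      then show "j \<in> J <+> K" using j K.zero_closed unfolding set_add_def' by blast
    qed
  qed
  then show ?thesis using a_setmult_rcos_assoc[OF J.a_subset K.a_subset a] by simp
qed

end

section \<open>Calculus of congruences modulo an ideal\<close>

lemma (in ideal) congr_left_iff:
  assumes "u \<in> carrier R" "v \<in> carrier R" "w \<in> carrier R" "v \<ominus> w \<in> I"
  shows "u \<ominus> v \<in> I \<longleftrightarrow> u \<ominus> w \<in> I"
proof -
  have 1: "u \<ominus> w = (u \<ominus> v) \<oplus> (v \<ominus> w)" and 2: "u \<ominus> v = (u \<ominus> w) \<oplus> \<ominus> (v \<ominus> w)"
    using assms(1-3) by algebra+
  show ?thesis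
  proof
    assume "u \<ominus> v \<in> I"
    then show "u \<ominus> w \<in> I" using 1 assms(4) by simp
  next
    assume "u \<ominus> w \<in> I"
    then show "u \<ominus> v \<in> I" using 2 assms(4) by simp
  qed
qed

lemma (in ideal) congr_trans:
  assumes "u \<in> carrier R" "v \<in> carrier R" "w \<in> carrier R" "u \<ominus> v \<in> I" "v \<ominus> w \<in> I"
  shows "u \<ominus> w \<in> I"
  using congr_left_iff assms by blast

lemma (in ideal) congr_sym:
  assumes "u \<in> carrier R" "v \<in> carrier R" "u \<ominus> v \<in> I"
  shows "v \<ominus> u \<in> I"
proof -
  have "v \<ominus> u = \<ominus> (u \<ominus> v)" using assms(1,2) by algebra
  then show ?thesis using assms(3) by simp
qed

lemma (in ideal) congr_mult:
  assumes "u \<in> carrier R" "v \<in> carrier R" "u' \<in> carrier R" "v' \<in> carrier R"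
    and "u \<ominus> u' \<in> I" "v \<ominus> v' \<in> I"
  shows "u \<otimes> v \<ominus> u' \<otimes> v' \<in> I"
proof -
  have "u \<otimes> v \<ominus> u' \<otimes> v' = u \<otimes> (v \<ominus> v') \<oplus> (u \<ominus> u') \<otimes> v'"
    using assms(1-4) by algebra
  then show ?thesis using assms by (simp add: I_l_closed I_r_closed)
qed

lemma (in ideal) congr_add:
  assumes "u \<in> carrier R" "v \<in> carrier R" "u' \<in> carrier R" "v' \<in> carrier R"
    and "u \<ominus> u' \<in> I" "v \<ominus> v' \<in> I"
  shows "(u \<oplus> v) \<ominus> (u' \<oplus> v') \<in> I"
proof -
  have "(u \<oplus> v) \<ominus> (u' \<oplus> v') = (v \<ominus> v') \<oplus> (u \<ominus> u')"
    using assms(1-4) by algebra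
  then show ?thesis using assms by simp
qed

lemma adic_completion_simps:
  "carrier (adic_completion A I) =
     {x. (\<forall>n. \<exists>a\<in>carrier A. x n = ideal_power A I n +>\<^bsub>A\<^esub> a) \<and>
         (\<forall>m n. m \<le> n \<longrightarrow> ideal_power A I m <+>\<^bsub>A\<^esub> x n = x m)}"
  "x \<otimes>\<^bsub>adic_completion A I\<^esub> y = (\<lambda>n. [mod (ideal_power A I n):] x n \<Otimes>\<^bsub>A\<^esub> y n)"
  "x \<oplus>\<^bsub>adic_completion A I\<^esub> y = (\<lambda>n. x n <+>\<^bsub>A\<^esub> y n)"
  "\<one>\<^bsub>adic_completion A I\<^esub> = (\<lambda>n. ideal_power A I n +>\<^bsub>A\<^esub> \<one>\<^bsub>A\<^esub>)"
  "\<zero>\<^bsub>adic_completion A I\<^esub> = ideal_power A I"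
  by (auto simp: adic_completion_def Let_def FactRing_def A_RCOSETS_def')

section \<open>The completion of a ring that approximates a p-ring\<close>

text \<open>
  The hypotheses say that \<open>\<alpha>\<close> induces isomorphisms \<open>A/I\<^sup>n \<cong> W/\<aa>\<^sub>n\<close> for all \<open>n \<ge> 1\<close>.
\<close>

locale adic_approximation =
  hom: ring_hom_cring A W \<alpha> + W: p_ring W p \<aa> + I: ideal I A
  for A :: "('a, 'm) ring_scheme" and W :: "('b, 'n) ring_scheme" and \<alpha> p \<aa> I +
  assumes vimage: "\<lbrakk>n \<ge> 1; a \<in> carrier A\<rbrakk> \<Longrightarrow> \<alpha> a \<in> \<aa> n \<longleftrightarrow> a \<in> ideal_power A I n"
    and dense: "\<lbrakk>n \<ge> 1; w \<in> carrier W\<rbrakk> \<Longrightarrow> \<exists>a\<in>carrier A. \<alpha> a \<ominus>\<^bsub>W\<^esub> w \<in> \<aa> n"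
begin

text \<open>The value \<open>\<aa> 0\<close> is arbitrary, whereas \<open>I\<^sup>0 = A\<close>; hence the correction at \<open>0\<close>.\<close>

definition \<bb> :: "nat \<Rightarrow> 'b set" where
  "\<bb> n = (if n = 0 then carrier W else \<aa> n)"

lemma \<bb>_ideal: "ideal (\<bb> n) W"
  unfolding \<bb>_def using W.ideal_seq[of n] hom.S.oneideal by auto

lemma \<bb>_antimono: "m \<le> n \<Longrightarrow> \<bb> n \<subseteq> \<bb> m"
  unfolding \<bb>_def using W.antimono_filtration[of m n] ideal.Icarr[OF W.ideal_seq[of n]] by auto

lemma vimage_\<bb>: "a \<in> carrier A \<Longrightarrow> \<alpha> a \<in> \<bb> n \<longleftrightarrow> a \<in> ideal_power A I n"
  unfolding \<bb>_def using vimage[of n a] by auto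

lemma dense_\<bb>:
  assumes "w \<in> carrier W"
  obtains a where "a \<in> carrier A" "\<alpha> a \<ominus>\<^bsub>W\<^esub> w \<in> \<bb> n"
proof (cases "n = 0")
  case True
  have "\<alpha> \<zero>\<^bsub>A\<^esub> \<ominus>\<^bsub>W\<^esub> w \<in> \<bb> n"
    unfolding True \<bb>_def using assms by (simp add: a_minus_def)
  then show ?thesis by (rule that[rotated]) simp
next
  case False
  then show ?thesis using dense[of n w] assms that unfolding \<bb>_def by auto
qed

text \<open>The component at \<open>n\<close> is the full preimage in \<open>A\<close> of the coset
  of \<open>w\<close> modulo \<open>\<bb> n\<close>. Taking all approximations rather than one
  avoids choices and any question of well-definedness.\<close>

definition completion_map :: "'b \<Rightarrow> nat \<Rightarrow> 'a set" where
  "completion_map w n = {a \<in> carrier A. \<alpha> a \<ominus>\<^bsub>W\<^esub> w \<in> \<bb> n}"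

lemma power_ideal: "ideal (ideal_power A I n) A"
  by (rule hom.R.ideal_power_ideal) (rule I.ideal_axioms)

text \<open>Two approximations differ by an element that \<open>\<alpha>\<close> sends into
  \<open>\<bb> n\<close>, that is, by an element of the \<open>n\<close>-th power of
  \<open>I\<close>. Any approximation thus represents the component, and ring operations can be
  computed on representatives.\<close>

lemma completion_map_eq_coset:
  assumes w: "w \<in> carrier W" and a: "a \<in> carrier A" "\<alpha> a \<ominus>\<^bsub>W\<^esub> w \<in> \<bb> n"
  shows "completion_map w n = ideal_power A I n +>\<^bsub>A\<^esub> a"
proof -
  interpret P: ideal "ideal_power A I n" A by (rule power_ideal)
  interpret B: ideal "\<bb> n" W by (rule \<bb>_ideal)
  have "x \<in> completion_map w n \<longleftrightarrow> x \<in> ideal_power A I n +>\<^bsub>A\<^esub> a" if x: "x \<in> carrier A" for x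
  proof -
    have "x \<in> ideal_power A I n +>\<^bsub>A\<^esub> a \<longleftrightarrow> x \<ominus>\<^bsub>A\<^esub> a \<in> ideal_power A I n"
      by (rule P.a_rcos_module_minus[OF hom.R.ring_axioms a(1) x])
    also have "\<dots> \<longleftrightarrow> \<alpha> (x \<ominus>\<^bsub>A\<^esub> a) \<in> \<bb> n"
      by (rule vimage_\<bb>[symmetric]) (use a(1) x in simp)
    also have "\<alpha> (x \<ominus>\<^bsub>A\<^esub> a) = \<alpha> x \<ominus>\<^bsub>W\<^esub> \<alpha> a" using a(1) x by (simp add: a_minus_def)
    also have "\<dots> \<in> \<bb> n \<longleftrightarrow> \<alpha> x \<ominus>\<^bsub>W\<^esub> w \<in> \<bb> n"
      by (rule B.congr_left_iff) (use a x w in auto)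
    finally show ?thesis using x by (simp add: completion_map_def)
  qed
  moreover have "ideal_power A I n +>\<^bsub>A\<^esub> a \<subseteq> carrier A"
    using hom.R.a_r_coset_subset_G[OF P.a_subset a(1)] .
  ultimately show ?thesis unfolding completion_map_def by blast
qed

lemma completion_map_closed:
  assumes w: "w \<in> carrier W"
  shows "completion_map w \<in> carrier (adic_completion A I)"
  unfolding adic_completion_simps mem_Collect_eq
proof (intro conjI allI impI)
  fix n
  obtain a where "a \<in> carrier A" "\<alpha> a \<ominus>\<^bsub>W\<^esub> w \<in> \<bb> n" using dense_\<bb>[OF w] .
  then show "\<exists>a\<in>carrier A. completion_map w n = ideal_power A I n +>\<^bsub>A\<^esub> a"
    using completion_map_eq_coset[OF w] by blast
next
  fix m n :: nat assume mn: "m \<le> n"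
  obtain a where a: "a \<in> carrier A" "\<alpha> a \<ominus>\<^bsub>W\<^esub> w \<in> \<bb> n" using dense_\<bb>[OF w] .
  have "ideal_power A I m <+>\<^bsub>A\<^esub> completion_map w n = ideal_power A I m +>\<^bsub>A\<^esub> a"
    unfolding completion_map_eq_coset[OF w a]
    by (rule hom.R.add_subideal_coset)
      (use power_ideal a(1) hom.R.ideal_power_antimono[OF I.ideal_axioms mn] in auto)
  \<comment> \<open>An approximation modulo \<open>\<bb> n\<close> is also one modulo the larger
    \<open>\<bb> m\<close>, so the same \<open>a\<close> serves both levels.\<close>
  also have "\<dots> = completion_map w m"
    by (rule completion_map_eq_coset[symmetric]) (use w a \<bb>_antimono[OF mn] in auto)
  finally show "ideal_power A I m <+>\<^bsub>A\<^esub> completion_map w n = completion_map w m" .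
qed

lemma completion_map_mult:
  assumes w: "w \<in> carrier W" and v: "v \<in> carrier W"
  shows "completion_map (w \<otimes>\<^bsub>W\<^esub> v) = completion_map w \<otimes>\<^bsub>adic_completion A I\<^esub> completion_map v"
  unfolding adic_completion_simps
proof
  fix n
  interpret P: ideal "ideal_power A I n" A by (rule power_ideal)
  interpret B: ideal "\<bb> n" W by (rule \<bb>_ideal)
  obtain a where a: "a \<in> carrier A" "\<alpha> a \<ominus>\<^bsub>W\<^esub> w \<in> \<bb> n" using dense_\<bb>[OF w] .
  obtain b where b: "b \<in> carrier A" "\<alpha> b \<ominus>\<^bsub>W\<^esub> v \<in> \<bb> n" using dense_\<bb>[OF v] .
  have "\<alpha> (a \<otimes>\<^bsub>A\<^esub> b) \<ominus>\<^bsub>W\<^esub> w \<otimes>\<^bsub>W\<^esub> v \<in> \<bb> n"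
    using B.congr_mult[of "\<alpha> a" "\<alpha> b" w v] a b w v by simp
  then have "completion_map (w \<otimes>\<^bsub>W\<^esub> v) n = ideal_power A I n +>\<^bsub>A\<^esub> (a \<otimes>\<^bsub>A\<^esub> b)"
    by (intro completion_map_eq_coset) (use a b w v in auto)
  then show "completion_map (w \<otimes>\<^bsub>W\<^esub> v) n =
      [mod ideal_power A I n:] completion_map w n \<Otimes>\<^bsub>A\<^esub> completion_map v n"
    using P.rcoset_mult_add a b by (simp add: completion_map_eq_coset[OF w a] completion_map_eq_coset[OF v b])
qed

lemma completion_map_add:
  assumes w: "w \<in> carrier W" and v: "v \<in> carrier W"
  shows "completion_map (w \<oplus>\<^bsub>W\<^esub> v) = completion_map w \<oplus>\<^bsub>adic_completion A I\<^esub> completion_map v"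
  unfolding adic_completion_simps
proof
  fix n
  interpret P: ideal "ideal_power A I n" A by (rule power_ideal)
  interpret B: ideal "\<bb> n" W by (rule \<bb>_ideal)
  obtain a where a: "a \<in> carrier A" "\<alpha> a \<ominus>\<^bsub>W\<^esub> w \<in> \<bb> n" using dense_\<bb>[OF w] .
  obtain b where b: "b \<in> carrier A" "\<alpha> b \<ominus>\<^bsub>W\<^esub> v \<in> \<bb> n" using dense_\<bb>[OF v] .
  have "\<alpha> (a \<oplus>\<^bsub>A\<^esub> b) \<ominus>\<^bsub>W\<^esub> (w \<oplus>\<^bsub>W\<^esub> v) \<in> \<bb> n"
    using B.congr_add[of "\<alpha> a" "\<alpha> b" w v] a b w v by simp
  then have "completion_map (w \<oplus>\<^bsub>W\<^esub> v) n = ideal_power A I n +>\<^bsub>A\<^esub> (a \<oplus>\<^bsub>A\<^esub> b)"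
    by (intro completion_map_eq_coset) (use a b w v in auto)
  then show "completion_map (w \<oplus>\<^bsub>W\<^esub> v) n = completion_map w n <+>\<^bsub>A\<^esub> completion_map v n"
    using P.a_rcos_sum a b by (simp add: completion_map_eq_coset[OF w a] completion_map_eq_coset[OF v b])
qed

lemma completion_map_one: "completion_map \<one>\<^bsub>W\<^esub> = \<one>\<^bsub>adic_completion A I\<^esub>"
proof
  fix n
  interpret B: ideal "\<bb> n" W by (rule \<bb>_ideal)
  show "completion_map \<one>\<^bsub>W\<^esub> n = \<one>\<^bsub>adic_completion A I\<^esub> n"
    unfolding adic_completion_simps
    by (rule completion_map_eq_coset) (simp_all add: hom.S.minus_eq hom.S.r_neg)
qed

lemma completion_map_zero: "completion_map \<zero>\<^bsub>W\<^esub> = \<zero>\<^bsub>adic_completion A I\<^esub>"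
proof
  fix n
  have "a \<in> carrier A \<and> \<alpha> a \<ominus>\<^bsub>W\<^esub> \<zero>\<^bsub>W\<^esub> \<in> \<bb> n \<longleftrightarrow> a \<in> ideal_power A I n" for a
    using vimage_\<bb>[of a n] ideal.Icarr[OF power_ideal[of n], of a]
    by (cases "a \<in> carrier A") (auto simp: a_minus_def)
  then show "completion_map \<zero>\<^bsub>W\<^esub> n = \<zero>\<^bsub>adic_completion A I\<^esub> n"
    unfolding adic_completion_simps completion_map_def by simp
qed

text \<open>At each level some \<open>a\<close> approximates both elements, so their difference lies
  in every \<open>\<aa> i\<close>; separation of \<open>W\<close> concludes.\<close>

lemma completion_map_inj:
  assumes w: "w \<in> carrier W" and v: "v \<in> carrier W" and eq: "completion_map w = completion_map v"
  shows "w = v"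
proof -
  have "w \<ominus>\<^bsub>W\<^esub> v \<in> \<aa> i" if "i \<ge> 1" for i
  proof -
    interpret J: ideal "\<aa> i" W by (rule W.ideal_seq[OF that])
    obtain a where a: "a \<in> carrier A" "\<alpha> a \<ominus>\<^bsub>W\<^esub> w \<in> \<bb> i" using dense_\<bb>[OF w] .
    then have "a \<in> completion_map v i" unfolding eq[symmetric] completion_map_def by simp
    then have "\<alpha> a \<ominus>\<^bsub>W\<^esub> v \<in> \<aa> i" "\<alpha> a \<ominus>\<^bsub>W\<^esub> w \<in> \<aa> i"
      using that a(2) unfolding completion_map_def \<bb>_def by auto
    then show ?thesis
      using J.congr_sym[of "\<alpha> a" w] J.congr_left_iff[of w "\<alpha> a" v] a(1) w v by simp
  qed
  then have "w \<ominus>\<^bsub>W\<^esub> v = \<zero>\<^bsub>W\<^esub>" using W.separated w v by simp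
  then show ?thesis using w v by simp
qed

text \<open>Here completeness of \<open>W\<close> enters: images of representatives of a compatible
  family form a Cauchy sequence, and its limit is the preimage.\<close>

lemma completion_map_surj:
  assumes x: "x \<in> carrier (adic_completion A I)"
  shows "\<exists>w\<in>carrier W. completion_map w = x"
proof -
  have "\<forall>n. \<exists>a\<in>carrier A. x n = ideal_power A I n +>\<^bsub>A\<^esub> a"
    and compat: "\<And>m n. m \<le> n \<Longrightarrow> ideal_power A I m <+>\<^bsub>A\<^esub> x n = x m"
    using x unfolding adic_completion_simps by blast+
  then obtain a where a: "\<And>n. a n \<in> carrier A" "\<And>n. x n = ideal_power A I n +>\<^bsub>A\<^esub> a n" by metis
  have step: "\<alpha> (a n) \<ominus>\<^bsub>W\<^esub> \<alpha> (a m) \<in> \<bb> k" if "k \<le> m" "k \<le> n" for m n k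
  proof -
    interpret P: ideal "ideal_power A I k" A by (rule power_ideal)
    \<comment> \<open>By compatibility every later representative \<open>a l\<close> also represents
      the component at \<open>k\<close>.\<close>
    have *: "ideal_power A I k +>\<^bsub>A\<^esub> a l = x k" if "k \<le> l" for l
      using compat[OF that] unfolding a(2)[of l]
      using hom.R.add_subideal_coset[OF power_ideal power_ideal
          hom.R.ideal_power_antimono[OF I.ideal_axioms that] a(1)[of l]] by simp
    have "a n \<in> ideal_power A I k +>\<^bsub>A\<^esub> a n"
      by (rule P.a_rcos_self) (rule a(1))
    then have "a n \<in> ideal_power A I k +>\<^bsub>A\<^esub> a m" using *[OF that(1)] *[OF that(2)] by simp
    then have "a n \<ominus>\<^bsub>A\<^esub> a m \<in> ideal_power A I k"
      using P.a_rcos_module_minus[OF hom.R.ring_axioms a(1) a(1)] by blast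
    then have "\<alpha> (a n \<ominus>\<^bsub>A\<^esub> a m) \<in> \<bb> k"
      using vimage_\<bb>[of "a n \<ominus>\<^bsub>A\<^esub> a m" k] a(1) hom.R.minus_closed by blast
    then show ?thesis using a(1) by (simp add: a_minus_def)
  qed
  have "ideal_Cauchy W \<aa> (\<lambda>n. \<alpha> (a n))"
    unfolding ideal_Cauchy_def
  proof (intro conjI allI impI)
    fix i :: nat assume "i \<ge> 1"
    then show "\<exists>N. \<forall>m\<ge>N. \<forall>n\<ge>N. \<alpha> (a m) \<ominus>\<^bsub>W\<^esub> \<alpha> (a n) \<in> \<aa> i"
      using step[of i] by (intro exI[of _ i]) (auto simp: \<bb>_def)
  qed (use a(1) in auto)
  then obtain w where w: "w \<in> carrier W"
    "\<And>i. i \<ge> 1 \<Longrightarrow> \<exists>N. \<forall>n\<ge>N. \<alpha> (a n) \<ominus>\<^bsub>W\<^esub> w \<in> \<aa> i"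
    using W.Cauchy_limit by blast
  have "\<alpha> (a n) \<ominus>\<^bsub>W\<^esub> w \<in> \<bb> n" for n
  proof (cases "n = 0")
    case True
    then show ?thesis using a(1) w(1) by (simp add: \<bb>_def)
  next
    case False
    interpret B: ideal "\<bb> n" W by (rule \<bb>_ideal)
    obtain N where "\<forall>k\<ge>N. \<alpha> (a k) \<ominus>\<^bsub>W\<^esub> w \<in> \<aa> n" using w(2)[of n] False by auto
    then have "\<alpha> (a (max N n)) \<ominus>\<^bsub>W\<^esub> w \<in> \<bb> n" using False by (simp add: \<bb>_def)
    \<comment> \<open>The index \<open>max N n\<close> is late enough both for the limit and for
      compatibility at level \<open>n\<close>.\<close>
    moreover have "\<alpha> (a n) \<ominus>\<^bsub>W\<^esub> \<alpha> (a (max N n)) \<in> \<bb> n" by (rule step) auto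
    ultimately show ?thesis using B.congr_left_iff a(1) w(1) hom.hom_closed by metis
  qed
  then have "completion_map w n = x n" for n
    using completion_map_eq_coset[OF w(1) a(1)[of n]] a(2)[of n] by simp
  then show ?thesis using w(1) by blast
qed

lemma completion_map_iso: "completion_map \<in> ring_iso W (adic_completion A I)"
proof (rule ring_iso_memI)
  show "bij_betw completion_map (carrier W) (carrier (adic_completion A I))"
    using completion_map_closed completion_map_inj completion_map_surj
    by (intro bij_betwI') (blast, blast, metis)
qed (use completion_map_closed completion_map_mult completion_map_add completion_map_one in auto)

text \<open>The ring laws are inherited from \<open>W\<close> through the bijection, instead of
  being checked on compatible families.\<close>

lemma adic_completion_cring: "cring (adic_completion A I)"
proof -
  \<comment> \<open>The library transport replaces the zero by the image of the old zero; here this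
    changes nothing.\<close>
  have "(adic_completion A I)\<lparr>zero := completion_map \<zero>\<^bsub>W\<^esub>\<rparr> = adic_completion A I"
    unfolding completion_map_zero by simp
  then show ?thesis using hom.S.ring_iso_imp_img_cring[OF completion_map_iso] by simp
qed

text \<open>One direction needs only the component at \<open>i\<close>. For the other, an
  approximation at a level \<open>n \<ge> i\<close> also approximates \<open>w\<close> modulo
  \<open>\<aa> i\<close>, hence lies in the \<open>i\<close>-th power of \<open>I\<close> when
  \<open>w\<close> is in \<open>\<aa> i\<close>.\<close>

lemma completion_map_mem_iff:
  assumes i: "i \<ge> 1" and w: "w \<in> carrier W"
  shows "completion_map w \<in> completed_ideal_power A I i \<longleftrightarrow> w \<in> \<aa> i"
proof -
  interpret J: ideal "\<aa> i" W by (rule W.ideal_seq[OF i])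
  have *: "a \<in> ideal_power A I i \<longleftrightarrow> w \<in> \<aa> i" if a: "a \<in> carrier A" "\<alpha> a \<ominus>\<^bsub>W\<^esub> w \<in> \<aa> i" for a
  proof -
    have "\<zero>\<^bsub>W\<^esub> \<ominus>\<^bsub>W\<^esub> \<alpha> a \<in> \<aa> i \<longleftrightarrow> \<zero>\<^bsub>W\<^esub> \<ominus>\<^bsub>W\<^esub> w \<in> \<aa> i"
      by (rule J.congr_left_iff) (use a w in auto)
    moreover have "\<zero>\<^bsub>W\<^esub> \<ominus>\<^bsub>W\<^esub> v \<in> \<aa> i \<longleftrightarrow> v \<in> \<aa> i" if v: "v \<in> carrier W" for v
    proof -
      have "\<zero>\<^bsub>W\<^esub> \<ominus>\<^bsub>W\<^esub> v = \<ominus>\<^bsub>W\<^esub> v" using v by (simp add: a_minus_def)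
      then show ?thesis using J.a_inv_closed[of v] J.a_inv_closed[of "\<ominus>\<^bsub>W\<^esub> v"] v by auto
    qed
    ultimately show ?thesis using vimage[OF i a(1)] a(1) w hom.hom_closed by blast
  qed
  show ?thesis
  proof
    assume "completion_map w \<in> completed_ideal_power A I i"
    then obtain a where a: "a \<in> ideal_power A I i" "completion_map w i = ideal_power A I i +>\<^bsub>A\<^esub> a"
      unfolding completed_ideal_power_def by auto
    interpret P: ideal "ideal_power A I i" A by (rule power_ideal)
    have "a \<in> completion_map w i" unfolding a(2) using P.a_rcos_self P.Icarr a(1) by blast
    then show "w \<in> \<aa> i" using * a(1) P.Icarr[OF a(1)] i unfolding completion_map_def \<bb>_def by auto
  next
    assume w': "w \<in> \<aa> i"
    have "completion_map w n \<in> (\<lambda>a. ideal_power A I n +>\<^bsub>A\<^esub> a) ` ideal_power A I i" if n: "n \<ge> i" for n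
    proof -
      obtain a where a: "a \<in> carrier A" "\<alpha> a \<ominus>\<^bsub>W\<^esub> w \<in> \<bb> n" using dense_\<bb>[OF w] .
      have "\<alpha> a \<ominus>\<^bsub>W\<^esub> w \<in> \<aa> i" using a(2) \<bb>_antimono[OF n] i by (auto simp: \<bb>_def)
      then have "a \<in> ideal_power A I i" using * a(1) w' by blast
      then show ?thesis using completion_map_eq_coset[OF w a] by blast
    qed
    then show "completion_map w \<in> completed_ideal_power A I i"
      unfolding completed_ideal_power_def using completion_map_closed[OF w] by blast
  qed
qed

end

lemma (in cring) ideal_power_mult_mem:
  assumes I: "ideal I R" and "x \<in> ideal_power R I m" "y \<in> ideal_power R I n"
  shows "x \<otimes> y \<in> ideal_power R I (m + n)"
proof -
  interpret S: comm_monoid "ideals_set R" by (rule ideals_set_is_comm_monoid)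
  have "I \<in> carrier (ideals_set R)" using I by (simp add: ideals_set_def)
  then have "ideal_power R I m \<cdot> ideal_power R I n = ideal_power R I (m + n)"
    unfolding ideal_power_def using S.nat_pow_mult[of I m n] by (simp add: ideals_set_def)
  then show ?thesis using ideal_prod.prod[OF assms(2,3), of R] by simp
qed

lemma (in cring) nat_smult_one_mem_ideal_power:
  assumes I: "ideal I R" and "[(k::nat)] \<cdot> \<one> \<in> I"
  shows "[(k ^ n)] \<cdot> \<one> \<in> ideal_power R I n"
proof (induction n)
  case (Suc n)
  then have "[(k ^ n)] \<cdot> \<one> \<otimes> [k] \<cdot> \<one> \<in> ideal_power R I n \<cdot> I"
    using assms(2) by (rule ideal_prod.prod)
  then show ?case unfolding ideal_power_Suc nat_smult_one_mult[symmetric] by (simp add: mult.commute)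
qed simp

section \<open>Teichmueller representatives\<close>

text \<open>The identification of the residue algebra with \<open>R\<close> is recorded as a
  surjection \<open>q\<close> with kernel \<open>\<aa> 1\<close>, so that elements of
  \<open>R\<close> can be lifted directly to \<open>W\<close>.\<close>

locale strict_p_ring_residue =
  W: strict_p_ring W p \<aa> + q: ring_hom_cring W R q
  for W :: "('b, 'n) ring_scheme" and R :: "('a, 'm) ring_scheme" and p \<aa> q +
  assumes prime_p: "Factorial_Ring.prime p"
    and perfect: "perfect_Fp_algebra p R"
    and q_surj: "q ` carrier W = carrier R"
    and q_kernel: "w \<in> carrier W \<Longrightarrow> q w = \<zero>\<^bsub>R\<^esub> \<longleftrightarrow> w \<in> \<aa> 1"
begin

lemma mem_\<aa>_iff:
  assumes "n \<ge> 1"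
  shows "x \<in> \<aa> n \<longleftrightarrow> (\<exists>y\<in>carrier W. x = add_pow W (p ^ n) \<one>\<^bsub>W\<^esub> \<otimes>\<^bsub>W\<^esub> y)"
  unfolding W.ideal_eq_power[OF assms] cgenideal_def using W.m_comm by auto

lemma q_eq_iff:
  assumes "x \<in> carrier W" "y \<in> carrier W"
  shows "q x = q y \<longleftrightarrow> x \<ominus>\<^bsub>W\<^esub> y \<in> \<aa> 1"
proof -
  have "q (x \<ominus>\<^bsub>W\<^esub> y) = q x \<ominus>\<^bsub>R\<^esub> q y" using assms by (simp add: a_minus_def)
  then show ?thesis using q_kernel[of "x \<ominus>\<^bsub>W\<^esub> y"] assms by simp
qed

lemma q_p: "add_pow R p \<one>\<^bsub>R\<^esub> = \<zero>\<^bsub>R\<^esub>"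
proof -
  have "add_pow W p \<one>\<^bsub>W\<^esub> \<in> \<aa> 1"
    unfolding mem_\<aa>_iff[OF order_refl] by (rule bexI[of _ "\<one>\<^bsub>W\<^esub>"]) simp_all
  then show ?thesis using q_kernel[of "add_pow W p \<one>\<^bsub>W\<^esub>"] by (simp add: q.hom_nat_smult_one)
qed

text \<open>Equal residues mean congruence modulo \<open>\<aa> 1\<close>, and each of the
  \<open>n\<close> successive \<open>p\<close>-th powers gains one level by
  \<open>prime_power_congr\<close>; hence the index \<open>Suc n\<close>.\<close>

lemma power_congr:
  assumes x: "x \<in> carrier W" and y: "y \<in> carrier W" and "q x = q y"
  shows "x [^]\<^bsub>W\<^esub> (p ^ n) \<ominus>\<^bsub>W\<^esub> y [^]\<^bsub>W\<^esub> (p ^ n) \<in> \<aa> (Suc n)"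
proof (induction n)
  case 0
  then show ?case using assms q_eq_iff by simp
next
  case (Suc n)
  then obtain z where z: "z \<in> carrier W"
    "x [^]\<^bsub>W\<^esub> (p ^ n) \<ominus>\<^bsub>W\<^esub> y [^]\<^bsub>W\<^esub> (p ^ n) = add_pow W (p ^ Suc n) \<one>\<^bsub>W\<^esub> \<otimes>\<^bsub>W\<^esub> z"
    using mem_\<aa>_iff[of "Suc n"] by auto
  have "\<exists>w\<in>carrier W. (x [^]\<^bsub>W\<^esub> (p ^ n)) [^]\<^bsub>W\<^esub> p \<ominus>\<^bsub>W\<^esub> (y [^]\<^bsub>W\<^esub> (p ^ n)) [^]\<^bsub>W\<^esub> p =
      add_pow W (p ^ Suc (Suc n)) \<one>\<^bsub>W\<^esub> \<otimes>\<^bsub>W\<^esub> w"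
    by (rule W.prime_power_congr[OF prime_p _ _ _ z(1) z(2)]) (use x y in auto)
  then show ?case
    unfolding W.nat_pow_pow[OF x] W.nat_pow_pow[OF y]
    using mem_\<aa>_iff[of "Suc (Suc n)"] by (simp add: mult.commute)
qed

definition p_root :: "'a \<Rightarrow> 'a" where
  "p_root = inv_into (carrier R) (\<lambda>x. x [^]\<^bsub>R\<^esub> p)"

lemma frobenius_bij: "bij_betw (\<lambda>x. x [^]\<^bsub>R\<^esub> p) (carrier R) (carrier R)"
  by (rule ring_iso_memE(5)) (use perfect in \<open>simp add: perfect_Fp_algebra_def\<close>)

lemma p_root_closed: "r \<in> carrier R \<Longrightarrow> p_root r \<in> carrier R"
  unfolding p_root_def using bij_betw_inv_into[OF frobenius_bij] bij_betwE by blast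

lemma p_root_power: "r \<in> carrier R \<Longrightarrow> p_root r [^]\<^bsub>R\<^esub> p = r"
  unfolding p_root_def using bij_betw_inv_into_right[OF frobenius_bij] by simp

lemma power_inj:
  "\<lbrakk>r \<in> carrier R; s \<in> carrier R; r [^]\<^bsub>R\<^esub> p = s [^]\<^bsub>R\<^esub> p\<rbrakk> \<Longrightarrow> r = s"
  using bij_betw_imp_inj_on[OF frobenius_bij] by (auto dest: inj_onD)

lemma p_root_mult:
  assumes "r \<in> carrier R" "s \<in> carrier R"
  shows "p_root (r \<otimes>\<^bsub>R\<^esub> s) = p_root r \<otimes>\<^bsub>R\<^esub> p_root s"
  by (rule power_inj) (use assms p_root_closed p_root_power in \<open>auto simp: q.S.nat_pow_distrib\<close>)

lemma p_root_one: "p_root \<one>\<^bsub>R\<^esub> = \<one>\<^bsub>R\<^esub>"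
  by (rule power_inj) (use p_root_closed p_root_power in auto)

lemma iter_p_root_closed: "r \<in> carrier R \<Longrightarrow> (p_root ^^ n) r \<in> carrier R"
  by (induction n) (simp_all add: p_root_closed)

lemma iter_p_root_mult:
  "\<lbrakk>r \<in> carrier R; s \<in> carrier R\<rbrakk> \<Longrightarrow> (p_root ^^ n) (r \<otimes>\<^bsub>R\<^esub> s) = (p_root ^^ n) r \<otimes>\<^bsub>R\<^esub> (p_root ^^ n) s"
  by (induction n) (simp_all add: p_root_mult iter_p_root_closed)

lemma iter_p_root_one: "(p_root ^^ n) \<one>\<^bsub>R\<^esub> = \<one>\<^bsub>R\<^esub>"
  by (induction n) (simp_all add: p_root_one)

lemma lift_exists: "r \<in> carrier R \<Longrightarrow> \<exists>u\<in>carrier W. q u = r"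
  using q_surj by (metis imageE)

text \<open>
  Requiring the congruences for all lifts \<open>u\<close> of the \<open>p\<^sup>n\<close>-th root of \<open>r\<close>, rather than for a chosen one,
  makes multiplicativity immediate.
\<close>

definition is_teichmueller :: "'a \<Rightarrow> 'b \<Rightarrow> bool" where
  "is_teichmueller r w \<longleftrightarrow> w \<in> carrier W \<and>
     (\<forall>n. \<forall>u\<in>carrier W. q u = (p_root ^^ n) r \<longrightarrow> w \<ominus>\<^bsub>W\<^esub> u [^]\<^bsub>W\<^esub> (p ^ n) \<in> \<aa> (Suc n))"

text \<open>For every \<open>n\<close>, both candidates are congruent modulo
  \<open>\<aa> (Suc n)\<close> to the same power of one lift, so separation applies.\<close>

lemma is_teichmueller_unique:
  assumes r: "r \<in> carrier R" and w: "is_teichmueller r w" and v: "is_teichmueller r v"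
  shows "w = v"
proof -
  have wv: "w \<in> carrier W" "v \<in> carrier W" using w v unfolding is_teichmueller_def by auto
  have "w \<ominus>\<^bsub>W\<^esub> v \<in> \<aa> i" if "i \<ge> 1" for i
  proof -
    interpret J: ideal "\<aa> i" W by (rule W.ideal_seq[OF that])
    obtain n where n: "i = Suc n" using \<open>i \<ge> 1\<close> by (cases i) auto
    obtain u where u: "u \<in> carrier W" "q u = (p_root ^^ n) r"
      using lift_exists[OF iter_p_root_closed[OF r]] by blast
    have "w \<ominus>\<^bsub>W\<^esub> u [^]\<^bsub>W\<^esub> (p ^ n) \<in> \<aa> i" "v \<ominus>\<^bsub>W\<^esub> u [^]\<^bsub>W\<^esub> (p ^ n) \<in> \<aa> i"
      using w v u unfolding is_teichmueller_def n by auto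
    then show ?thesis using J.congr_left_iff J.congr_sym wv u(1) W.nat_pow_closed by meson
  qed
  then have "w \<ominus>\<^bsub>W\<^esub> v = \<zero>\<^bsub>W\<^esub>" using W.separated wv by simp
  then show ?thesis using wv by simp
qed

lemma is_teichmueller_exists:
  assumes r: "r \<in> carrier R"
  shows "\<exists>w. is_teichmueller r w"
proof -
  obtain l where l: "\<And>n. l n \<in> carrier W" "\<And>n. q (l n) = (p_root ^^ n) r"
    using lift_exists[OF iter_p_root_closed[OF r]] by metis
  define s where "s n = l n [^]\<^bsub>W\<^esub> (p ^ n)" for n
  have s: "s n \<in> carrier W" for n unfolding s_def using l(1) by simp
  \<comment> \<open>Both \<open>l (Suc n) ^ p\<close> and \<open>l n\<close> lift the
    \<open>p^n\<close>-th root of \<open>r\<close>, so their \<open>p^n\<close>-th powers agree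
    modulo \<open>\<aa> (Suc n)\<close>.\<close>
  have step: "s (Suc n) \<ominus>\<^bsub>W\<^esub> s n \<in> \<aa> (Suc n)" for n
  proof -
    have "q (l (Suc n) [^]\<^bsub>W\<^esub> p) = q (l n)"
      using l p_root_power[OF iter_p_root_closed[OF r]] by (simp add: q.ring.hom_nat_pow)
    then have "(l (Suc n) [^]\<^bsub>W\<^esub> p) [^]\<^bsub>W\<^esub> (p ^ n) \<ominus>\<^bsub>W\<^esub> s n \<in> \<aa> (Suc n)"
      unfolding s_def by (intro power_congr) (use l(1) in auto)
    then show ?thesis unfolding s_def using W.nat_pow_pow[OF l(1)] by simp
  qed
  have steps: "s m \<ominus>\<^bsub>W\<^esub> s n \<in> \<aa> (Suc n)" if "n \<le> m" for m n
    using that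
  proof (induction m rule: dec_induct)
    case base
    interpret J: ideal "\<aa> (Suc n)" W by (rule W.ideal_seq) simp
    show ?case using s by (simp add: W.minus_eq W.r_neg)
  next
    case (step m)
    interpret J: ideal "\<aa> (Suc n)" W by (rule W.ideal_seq) simp
    have "s (Suc m) \<ominus>\<^bsub>W\<^esub> s m \<in> \<aa> (Suc n)"
      using \<open>s (Suc m) \<ominus>\<^bsub>W\<^esub> s m \<in> \<aa> (Suc m)\<close>  W.antimono_filtration[of "Suc n" "Suc m"] step(1) by auto
    then show ?case using J.congr_trans s step.IH by blast
  qed
  have "ideal_Cauchy W \<aa> s"
    unfolding ideal_Cauchy_def
  proof (intro conjI allI impI)
    fix i :: nat assume i: "i \<ge> 1"
    interpret J: ideal "\<aa> i" W by (rule W.ideal_seq[OF i])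
    have "s m \<ominus>\<^bsub>W\<^esub> s i \<in> \<aa> i" if "m \<ge> i" for m
      using steps[OF that] W.decreasing[OF i] by blast
    then show "\<exists>N. \<forall>m\<ge>N. \<forall>n\<ge>N. s m \<ominus>\<^bsub>W\<^esub> s n \<in> \<aa> i"
      using J.congr_trans J.congr_sym s by (intro exI[of _ i]) meson
  qed (use s in auto)
  then obtain w where w: "w \<in> carrier W" "\<And>i. i \<ge> 1 \<Longrightarrow> \<exists>N. \<forall>n\<ge>N. s n \<ominus>\<^bsub>W\<^esub> w \<in> \<aa> i"
    using W.Cauchy_limit by blast
  have "w \<ominus>\<^bsub>W\<^esub> u [^]\<^bsub>W\<^esub> (p ^ n) \<in> \<aa> (Suc n)" if u: "u \<in> carrier W" "q u = (p_root ^^ n) r" for n u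
  proof -
    interpret J: ideal "\<aa> (Suc n)" W by (rule W.ideal_seq) simp
    obtain N where "\<forall>k\<ge>N. s k \<ominus>\<^bsub>W\<^esub> w \<in> \<aa> (Suc n)" using w(2)[of "Suc n"] by auto
    then have "s (max N n) \<ominus>\<^bsub>W\<^esub> w \<in> \<aa> (Suc n)" by simp
    moreover have "s (max N n) \<ominus>\<^bsub>W\<^esub> s n \<in> \<aa> (Suc n)" by (rule steps) simp
    ultimately have "w \<ominus>\<^bsub>W\<^esub> s n \<in> \<aa> (Suc n)"
      using J.congr_trans J.congr_sym s w(1) by meson
    \<comment> \<open>Passes from the chosen lift \<open>l n\<close> to an arbitrary lift
      \<open>u\<close> of the same root.\<close>
    moreover have "s n \<ominus>\<^bsub>W\<^esub> u [^]\<^bsub>W\<^esub> (p ^ n) \<in> \<aa> (Suc n)"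
      unfolding s_def by (rule power_congr) (use u l in auto)
    ultimately show ?thesis using J.congr_trans s w(1) u(1) W.nat_pow_closed by meson
  qed
  then show ?thesis unfolding is_teichmueller_def using w(1) by blast
qed

lemma is_teichmueller_mult:
  assumes r: "r \<in> carrier R" and s: "s \<in> carrier R"
    and w: "is_teichmueller r w" and v: "is_teichmueller s v"
  shows "is_teichmueller (r \<otimes>\<^bsub>R\<^esub> s) (w \<otimes>\<^bsub>W\<^esub> v)"
proof -
  have wv: "w \<in> carrier W" "v \<in> carrier W" using w v unfolding is_teichmueller_def by auto
  have "w \<otimes>\<^bsub>W\<^esub> v \<ominus>\<^bsub>W\<^esub> u [^]\<^bsub>W\<^esub> (p ^ n) \<in> \<aa> (Suc n)"
    if u: "u \<in> carrier W" "q u = (p_root ^^ n) (r \<otimes>\<^bsub>R\<^esub> s)" for n u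
  proof -
    interpret J: ideal "\<aa> (Suc n)" W by (rule W.ideal_seq) simp
    obtain a where a: "a \<in> carrier W" "q a = (p_root ^^ n) r"
      using lift_exists[OF iter_p_root_closed[OF r]] by blast
    obtain b where b: "b \<in> carrier W" "q b = (p_root ^^ n) s"
      using lift_exists[OF iter_p_root_closed[OF s]] by blast
    have "w \<ominus>\<^bsub>W\<^esub> a [^]\<^bsub>W\<^esub> (p ^ n) \<in> \<aa> (Suc n)" "v \<ominus>\<^bsub>W\<^esub> b [^]\<^bsub>W\<^esub> (p ^ n) \<in> \<aa> (Suc n)"
      using w v a b unfolding is_teichmueller_def by auto
    then have "w \<otimes>\<^bsub>W\<^esub> v \<ominus>\<^bsub>W\<^esub> a [^]\<^bsub>W\<^esub> (p ^ n) \<otimes>\<^bsub>W\<^esub> b [^]\<^bsub>W\<^esub> (p ^ n) \<in> \<aa> (Suc n)"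
      by (intro J.congr_mult) (use wv a b in auto)
    then have "w \<otimes>\<^bsub>W\<^esub> v \<ominus>\<^bsub>W\<^esub> (a \<otimes>\<^bsub>W\<^esub> b) [^]\<^bsub>W\<^esub> (p ^ n) \<in> \<aa> (Suc n)"
      using a b by (simp add: W.nat_pow_distrib)
    \<comment> \<open>Roots are multiplicative in \<open>R\<close>, so \<open>a b\<close> and
      \<open>u\<close> lift the same element.\<close>
    moreover have "(a \<otimes>\<^bsub>W\<^esub> b) [^]\<^bsub>W\<^esub> (p ^ n) \<ominus>\<^bsub>W\<^esub> u [^]\<^bsub>W\<^esub> (p ^ n) \<in> \<aa> (Suc n)"
      by (rule power_congr) (use a b u iter_p_root_mult[OF r s] in auto)
    ultimately show ?thesis
      by (rule J.congr_trans[rotated 3]) (simp_all add: wv a(1) b(1) u(1))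
  qed
  then show ?thesis unfolding is_teichmueller_def using wv by blast
qed

lemma is_teichmueller_one: "is_teichmueller \<one>\<^bsub>R\<^esub> \<one>\<^bsub>W\<^esub>"
proof -
  have "\<one>\<^bsub>W\<^esub> \<ominus>\<^bsub>W\<^esub> u [^]\<^bsub>W\<^esub> (p ^ n) \<in> \<aa> (Suc n)"
    if "u \<in> carrier W" "q u = (p_root ^^ n) \<one>\<^bsub>R\<^esub>" for n u
    using power_congr[of "\<one>\<^bsub>W\<^esub>" u n] that iter_p_root_one by simp
  then show ?thesis unfolding is_teichmueller_def by simp
qed

lemma q_is_teichmueller:
  assumes r: "r \<in> carrier R" and w: "is_teichmueller r w"
  shows "q w = r"
proof -
  obtain u where u: "u \<in> carrier W" "q u = (p_root ^^ 0) r" using lift_exists[OF r] by auto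
  then have "w \<ominus>\<^bsub>W\<^esub> u [^]\<^bsub>W\<^esub> (p ^ 0) \<in> \<aa> (Suc 0)" "w \<in> carrier W"
    using w unfolding is_teichmueller_def by blast+
  then show ?thesis using q_eq_iff[of w u] u by simp
qed

definition teichmueller :: "'a \<Rightarrow> 'b" where
  "teichmueller r = (THE w. is_teichmueller r w)"

lemma is_teichmueller_teichmueller:
  assumes "r \<in> carrier R"
  shows "is_teichmueller r (teichmueller r)"
  unfolding teichmueller_def
  using theI'[of "is_teichmueller r"] is_teichmueller_exists is_teichmueller_unique assms by blast

lemma teichmueller_closed: "r \<in> carrier R \<Longrightarrow> teichmueller r \<in> carrier W"
  using is_teichmueller_teichmueller unfolding is_teichmueller_def by blast

lemma q_teichmueller: "r \<in> carrier R \<Longrightarrow> q (teichmueller r) = r"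
  using q_is_teichmueller is_teichmueller_teichmueller by blast

lemma teichmueller_one: "teichmueller \<one>\<^bsub>R\<^esub> = \<one>\<^bsub>W\<^esub>"
  using is_teichmueller_unique[OF q.S.one_closed is_teichmueller_teichmueller is_teichmueller_one] by simp

lemma teichmueller_hom: "teichmueller \<in> hom R W"
proof (rule homI)
  fix r s assume rs: "r \<in> carrier R" "s \<in> carrier R"
  show "teichmueller (r \<otimes>\<^bsub>R\<^esub> s) = teichmueller r \<otimes>\<^bsub>W\<^esub> teichmueller s"
    by (rule is_teichmueller_unique[of "r \<otimes>\<^bsub>R\<^esub> s"])
      (use rs is_teichmueller_teichmueller is_teichmueller_mult in auto)
qed (rule teichmueller_closed)

end

section \<open>The monoid algebra of a perfect algebra\<close>

context strict_p_ring_residue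
begin

abbreviation "A \<equiv> monoid_algebra_Z R"
abbreviation "I \<equiv> monoid_algebra_ker R"
abbreviation "\<pi> \<equiv> monoid_algebra_proj R"
abbreviation "\<alpha> \<equiv> monoid_algebra_lift W teichmueller"

lemma A_cring: "cring A"
  by (rule monoid_algebra_Z_cring) (rule q.S.comm_monoid_axioms)

lemma \<pi>_hom: "\<pi> \<in> ring_hom A R"
  unfolding monoid_algebra_proj_eq_lift
  by (rule monoid_algebra_lift_hom) (simp_all add: q.S.comm_monoid_axioms q.S.is_cring hom_def)

lemma \<alpha>_hom: "\<alpha> \<in> ring_hom A W"
  by (rule monoid_algebra_lift_hom)
    (simp_all add: q.S.comm_monoid_axioms W.is_cring teichmueller_hom teichmueller_one)

end

sublocale strict_p_ring_residue \<subseteq> A: cring A by (rule A_cring)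
sublocale strict_p_ring_residue \<subseteq> \<pi>: ring_hom_cring A R \<pi> by unfold_locales (rule \<pi>_hom)
sublocale strict_p_ring_residue \<subseteq> \<alpha>: ring_hom_cring A W \<alpha> by unfold_locales (rule \<alpha>_hom)

text \<open>The cancellation in the difference case of \<open>pth_root_mod_p\<close>, where
  \<open>b\<close> stands for the common \<open>p\<close>-th power and \<open>q\<close> for
  \<open>p\<close>.\<close>

lemma (in cring) sub_eq_of_common_summand:
  assumes "d \<in> carrier R" "b \<in> carrier R" "q \<in> carrier R" "u \<in> carrier R" "v \<in> carrier R" "w \<in> carrier R"
  shows "(d \<oplus> b \<oplus> q \<otimes> u \<oplus> q \<otimes> v) \<ominus> (b \<oplus> q \<otimes> w) = d \<oplus> q \<otimes> (u \<oplus> v \<ominus> w)"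
  using assms by algebra

context strict_p_ring_residue
begin

lemma frag_of_mem: "r \<in> carrier R \<Longrightarrow> frag_of r \<in> carrier A"
  by (simp add: carrier_monoid_algebra_Z)

lemma A_induct [consumes 1, case_names zero diff of]:
  assumes "c \<in> carrier A" and "P \<zero>\<^bsub>A\<^esub>"
    and "\<And>x y. \<lbrakk>x \<in> carrier A; y \<in> carrier A; P x; P y\<rbrakk> \<Longrightarrow> P (x \<ominus>\<^bsub>A\<^esub> y)"
    and "\<And>r. r \<in> carrier R \<Longrightarrow> P (frag_of r)"
  shows "P c"
proof -
  have "Poly_Mapping.keys c \<subseteq> carrier R" using assms(1) by (simp add: carrier_monoid_algebra_Z)
  then show ?thesis
  proof (induction c rule: free_Abelian_group_induct[consumes 1, case_names zero diff of])
    case (diff x y)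
    then have "x \<in> carrier A" "y \<in> carrier A" by (simp_all add: carrier_monoid_algebra_Z)
    then show ?case
      using assms(3) diff.IH monoid_algebra_Z_minus[OF q.S.comm_monoid_axioms] by metis
  qed (use assms(2,4) in \<open>auto simp: monoid_algebra_Z_simps\<close>)
qed

lemma \<pi>_of: "r \<in> carrier R \<Longrightarrow> \<pi> (frag_of r) = r"
  unfolding monoid_algebra_proj_eq_lift using q.S.monoid_algebra_lift_of[of "\<lambda>r. r" r] by simp

lemma \<alpha>_of: "r \<in> carrier R \<Longrightarrow> \<alpha> (frag_of r) = teichmueller r"
  using W.monoid_algebra_lift_of[of teichmueller r] teichmueller_closed by simp

lemma q_\<alpha>: "c \<in> carrier A \<Longrightarrow> q (\<alpha> c) = \<pi> c"
proof (induction c rule: A_induct)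
  case zero
  then show ?case by (simp)
next
  case (diff x y)
  then show ?case by (simp add: a_minus_def)
next
  case (of r)
  then show ?case by (simp add: \<pi>_of \<alpha>_of q_teichmueller)
qed

lemma I_eq: "I = {c \<in> carrier A. \<pi> c = \<zero>\<^bsub>R\<^esub>}"
  unfolding monoid_algebra_ker_def a_kernel_def' ..

lemma I_ideal: "ideal I A"
  unfolding monoid_algebra_ker_def by (rule \<pi>.ring.kernel_is_ideal)

lemma \<alpha>_mem_\<aa>_1_iff: "c \<in> carrier A \<Longrightarrow> \<alpha> c \<in> \<aa> 1 \<longleftrightarrow> c \<in> I"
  using q_kernel[of "\<alpha> c"] q_\<alpha>[of c] by (simp add: I_eq)

lemma p_mem_I: "add_pow A p \<one>\<^bsub>A\<^esub> \<in> I"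
  unfolding I_eq using \<pi>.hom_nat_smult_one[of p] q_p A.add.nat_pow_closed[OF A.one_closed, of p]
  by (simp)

lemma frag_of_power: "r \<in> carrier R \<Longrightarrow> frag_of r [^]\<^bsub>A\<^esub> (n::nat) = frag_of (r [^]\<^bsub>R\<^esub> n)"
  by (induction n) (simp_all add: monoid_algebra_Z_simps(2) monoid_algebra_mult_of)

section \<open>Powers of the augmentation ideal and their preimage description\<close>

text \<open>A generator is exactly the \<open>p\<close>-th power of the generator of its root, by
  perfectness of \<open>R\<close>; for differences, Frobenius is additive modulo \<open>p\<close> in
  any commutative ring.\<close>

lemma pth_root_mod_p:
  assumes "c \<in> carrier A"
  shows "\<exists>b\<in>carrier A. \<exists>z\<in>carrier A. c = b [^]\<^bsub>A\<^esub> p \<oplus>\<^bsub>A\<^esub> add_pow A p \<one>\<^bsub>A\<^esub> \<otimes>\<^bsub>A\<^esub> z"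
  using assms
proof (induction c rule: A_induct)
  case zero
  have "\<zero>\<^bsub>A\<^esub> = \<zero>\<^bsub>A\<^esub> [^]\<^bsub>A\<^esub> p \<oplus>\<^bsub>A\<^esub> add_pow A p \<one>\<^bsub>A\<^esub> \<otimes>\<^bsub>A\<^esub> \<zero>\<^bsub>A\<^esub>"
    using prime_gt_0_nat[OF prime_p] by (simp add: A.nat_pow_zero)
  then show ?case using A.zero_closed by blast
next
  case (of r)
  have "frag_of r = frag_of (p_root r) [^]\<^bsub>A\<^esub> p \<oplus>\<^bsub>A\<^esub> add_pow A p \<one>\<^bsub>A\<^esub> \<otimes>\<^bsub>A\<^esub> \<zero>\<^bsub>A\<^esub>"
    using of p_root_power p_root_closed frag_of_mem by (simp add: frag_of_power)
  then show ?case using A.zero_closed frag_of_mem[OF p_root_closed[OF of]] by blast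
next
  case (diff c c')
  let ?p = "add_pow A p \<one>\<^bsub>A\<^esub>"
  obtain b z where b: "b \<in> carrier A" "z \<in> carrier A" "c = b [^]\<^bsub>A\<^esub> p \<oplus>\<^bsub>A\<^esub> ?p \<otimes>\<^bsub>A\<^esub> z"
    using diff by blast
  obtain b' z' where b': "b' \<in> carrier A" "z' \<in> carrier A" "c' = b' [^]\<^bsub>A\<^esub> p \<oplus>\<^bsub>A\<^esub> ?p \<otimes>\<^bsub>A\<^esub> z'"
    using diff by blast
  \<comment> \<open>Expanding \<open>b = d + b'\<close>, rather than the power of a difference,
    avoids the sign \<open>(-1)^p\<close>.\<close>
  define d where "d = b \<ominus>\<^bsub>A\<^esub> b'"
  have d: "d \<in> carrier A" unfolding d_def using b b' by blast
  have bd: "b = d \<oplus>\<^bsub>A\<^esub> b'"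
    unfolding d_def using b(1) b'(1) by (simp add: A.minus_eq A.a_assoc A.l_neg)
  obtain t where t: "t \<in> carrier A"
    "b [^]\<^bsub>A\<^esub> p = d [^]\<^bsub>A\<^esub> p \<oplus>\<^bsub>A\<^esub> b' [^]\<^bsub>A\<^esub> p \<oplus>\<^bsub>A\<^esub> ?p \<otimes>\<^bsub>A\<^esub> (b' \<otimes>\<^bsub>A\<^esub> t)"
    using A.add_power_prime[OF prime_p d b'(1)] unfolding bd by blast
  have "c \<ominus>\<^bsub>A\<^esub> c' = d [^]\<^bsub>A\<^esub> p \<oplus>\<^bsub>A\<^esub> ?p \<otimes>\<^bsub>A\<^esub> (b' \<otimes>\<^bsub>A\<^esub> t \<oplus>\<^bsub>A\<^esub> z \<ominus>\<^bsub>A\<^esub> z')"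
    unfolding b(3) b'(3) t(2) by (rule A.sub_eq_of_common_summand) (use b b' d t in auto)
  moreover have "b' \<otimes>\<^bsub>A\<^esub> t \<oplus>\<^bsub>A\<^esub> z \<ominus>\<^bsub>A\<^esub> z' \<in> carrier A"
    using b b' t(1) by blast
  ultimately show ?case using d by blast
qed

lemma I_subset:
  assumes c: "c \<in> I"
  shows "\<exists>y\<in>ideal_power A I 2. \<exists>z\<in>carrier A. c = y \<oplus>\<^bsub>A\<^esub> add_pow A p \<one>\<^bsub>A\<^esub> \<otimes>\<^bsub>A\<^esub> z"
proof -
  interpret I: ideal I A by (rule I_ideal)
  have "c \<in> carrier A" and \<pi>c: "\<pi> c = \<zero>\<^bsub>R\<^esub>" using c unfolding I_eq by auto
  then obtain b z where b: "b \<in> carrier A" and z: "z \<in> carrier A"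
    and cb: "c = b [^]\<^bsub>A\<^esub> p \<oplus>\<^bsub>A\<^esub> add_pow A p \<one>\<^bsub>A\<^esub> \<otimes>\<^bsub>A\<^esub> z"
    using pth_root_mod_p by blast
  obtain k where k: "p = Suc (Suc k)"
    using prime_ge_2_nat[OF prime_p] by (metis Suc_diff_Suc add_2_eq_Suc le_Suc_ex)
  have "\<pi> c = \<pi> b [^]\<^bsub>R\<^esub> p"
    unfolding cb using b z by (simp add: \<pi>.ring.hom_nat_pow \<pi>.hom_nat_smult_one q_p)
  moreover have "\<zero>\<^bsub>R\<^esub> [^]\<^bsub>R\<^esub> p = \<zero>\<^bsub>R\<^esub>" unfolding k by simp
  ultimately have "\<pi> b [^]\<^bsub>R\<^esub> p = \<zero>\<^bsub>R\<^esub> [^]\<^bsub>R\<^esub> p" using \<pi>c by metis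
  \<comment> \<open>The multiple of \<open>p\<close> dies in \<open>R\<close>, so the image of
    \<open>b\<close> has \<open>p\<close>-th power zero; Frobenius is injective.\<close>
  then have "b \<in> I" unfolding I_eq using power_inj[of "\<pi> b" "\<zero>\<^bsub>R\<^esub>"] b by simp
  then have "b \<otimes>\<^bsub>A\<^esub> b \<in> ideal_power A I (Suc (Suc 0))"
    unfolding A.ideal_power_Suc[of I "Suc 0"] A.ideal_power_1[OF I_ideal] by (intro ideal_prod.prod)
  then have "b \<otimes>\<^bsub>A\<^esub> b \<in> ideal_power A I 2" by (simp add: numeral_2_eq_2)
  then have "b [^]\<^bsub>A\<^esub> k \<otimes>\<^bsub>A\<^esub> (b \<otimes>\<^bsub>A\<^esub> b) \<in> ideal_power A I 2"
    using ideal.I_l_closed[OF A.ideal_power_ideal[OF I_ideal]] b by simp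
  then have "b [^]\<^bsub>A\<^esub> p \<in> ideal_power A I 2" unfolding k using b by (simp add: A.m_assoc)
  then show ?thesis using cb z by blast
qed

text \<open>Multiplies a decomposition for the \<open>n\<close>-th power by the one for
  \<open>I\<close>. With \<open>i = y + p^n z\<close> and \<open>j = y' + p z'\<close>, only the
  last term of \<open>i j = y j + z p^n y' + p^(n+1) z z'\<close> can fall outside the next power of
  \<open>I\<close>.\<close>

lemma ideal_power_decomp:
  assumes "n \<ge> 1" and "c \<in> ideal_power A I n"
  shows "\<exists>y\<in>ideal_power A I (Suc n). \<exists>z\<in>carrier A. c = y \<oplus>\<^bsub>A\<^esub> add_pow A (p ^ n) \<one>\<^bsub>A\<^esub> \<otimes>\<^bsub>A\<^esub> z"
  using assms
proof (induction n arbitrary: c rule: dec_induct)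
  case base
  then show ?case using I_subset[of c] A.ideal_power_1[OF I_ideal] by (simp add: numeral_2_eq_2)
next
  case (step n)
  interpret J: ideal "ideal_power A I (Suc (Suc n))" A by (rule A.ideal_power_ideal[OF I_ideal])
  interpret K: ideal "ideal_power A I (Suc n)" A by (rule A.ideal_power_ideal[OF I_ideal])
  interpret L: ideal "ideal_power A I 2" A by (rule A.ideal_power_ideal[OF I_ideal])
  interpret I: ideal I A by (rule I_ideal)
  let ?q = "add_pow A (p ^ n) \<one>\<^bsub>A\<^esub>" and ?p = "add_pow A p \<one>\<^bsub>A\<^esub>"
  let ?pq = "add_pow A (p ^ Suc n) \<one>\<^bsub>A\<^esub>"
  have pq: "?pq = ?q \<otimes>\<^bsub>A\<^esub> ?p"
    unfolding A.nat_smult_one_mult[symmetric] by (simp add: mult.commute)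
  have qc: "?q \<in> carrier A" "?p \<in> carrier A" by simp_all
  from step.prems show ?case unfolding A.ideal_power_Suc[of I n]
  proof (induction c rule: ideal_prod.induct)
    case (prod i j)
    obtain y z where y: "y \<in> ideal_power A I (Suc n)" "z \<in> carrier A" "i = y \<oplus>\<^bsub>A\<^esub> ?q \<otimes>\<^bsub>A\<^esub> z"
      using step.IH[OF prod(1)] by blast
    obtain y' z' where y': "y' \<in> ideal_power A I 2" "z' \<in> carrier A" "j = y' \<oplus>\<^bsub>A\<^esub> ?p \<otimes>\<^bsub>A\<^esub> z'"
      using I_subset[OF prod(2)] by blast
    have c: "y \<in> carrier A" "y' \<in> carrier A" "j \<in> carrier A"
      using K.Icarr L.Icarr I.Icarr y y' prod by auto
    \<comment> \<open>Since \<open>p\<close> lies in \<open>I\<close>, the factor \<open>p^n\<close>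
      counts as an element of the \<open>n\<close>-th power of \<open>I\<close>.\<close>
    have "?q \<otimes>\<^bsub>A\<^esub> y' \<in> ideal_power A I (n + 2)"
      by (rule A.ideal_power_mult_mem[OF I_ideal A.nat_smult_one_mem_ideal_power[OF I_ideal p_mem_I] y'(1)])
    then have "z \<otimes>\<^bsub>A\<^esub> (?q \<otimes>\<^bsub>A\<^esub> y') \<in> ideal_power A I (Suc (Suc n))"
      using J.I_l_closed y(2) by simp
    moreover have "y \<otimes>\<^bsub>A\<^esub> j \<in> ideal_power A I (Suc (Suc n))"
      unfolding A.ideal_power_Suc[of I "Suc n"] using y(1) prod(2) by (rule ideal_prod.prod)
    ultimately have "y \<otimes>\<^bsub>A\<^esub> j \<oplus>\<^bsub>A\<^esub> z \<otimes>\<^bsub>A\<^esub> (?q \<otimes>\<^bsub>A\<^esub> y') \<in> ideal_power A I (Suc (Suc n))"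
      by simp
    moreover have "i \<otimes>\<^bsub>A\<^esub> j = (y \<otimes>\<^bsub>A\<^esub> j \<oplus>\<^bsub>A\<^esub> z \<otimes>\<^bsub>A\<^esub> (?q \<otimes>\<^bsub>A\<^esub> y')) \<oplus>\<^bsub>A\<^esub> ?pq \<otimes>\<^bsub>A\<^esub> (z \<otimes>\<^bsub>A\<^esub> z')"
    proof -
      have "i \<otimes>\<^bsub>A\<^esub> j = y \<otimes>\<^bsub>A\<^esub> j \<oplus>\<^bsub>A\<^esub> ?q \<otimes>\<^bsub>A\<^esub> z \<otimes>\<^bsub>A\<^esub> j"
        unfolding y(3) using y(2) c qc by (simp add: A.l_distr)
      also have "?q \<otimes>\<^bsub>A\<^esub> z \<otimes>\<^bsub>A\<^esub> j = z \<otimes>\<^bsub>A\<^esub> (?q \<otimes>\<^bsub>A\<^esub> y') \<oplus>\<^bsub>A\<^esub> ?q \<otimes>\<^bsub>A\<^esub> ?p \<otimes>\<^bsub>A\<^esub> (z \<otimes>\<^bsub>A\<^esub> z')"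
        unfolding y'(3) using y(2) y'(2) c qc by (simp add: A.r_distr A.m_ac)
      finally show ?thesis unfolding pq using y(2) y'(2) c qc by (simp add: A.a_assoc)
    qed
    ultimately show ?case using y(2) y'(2) by blast
  next
    case (sum s1 s2)
    obtain y z where y: "y \<in> ideal_power A I (Suc (Suc n))" "z \<in> carrier A" "s1 = y \<oplus>\<^bsub>A\<^esub> ?pq \<otimes>\<^bsub>A\<^esub> z"
      using sum by blast
    obtain y' z' where y': "y' \<in> ideal_power A I (Suc (Suc n))" "z' \<in> carrier A" "s2 = y' \<oplus>\<^bsub>A\<^esub> ?pq \<otimes>\<^bsub>A\<^esub> z'"
      using sum by blast
    have c: "y \<in> carrier A" "y' \<in> carrier A" using y(1) y'(1) J.Icarr by auto
    have "s1 \<oplus>\<^bsub>A\<^esub> s2 = (y \<oplus>\<^bsub>A\<^esub> y') \<oplus>\<^bsub>A\<^esub> ?pq \<otimes>\<^bsub>A\<^esub> (z \<oplus>\<^bsub>A\<^esub> z')"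
      unfolding y(3) y'(3) using c y(2) y'(2) by (simp add: A.r_distr A.a_ac del: power_Suc)
    then show ?case using J.a_closed[OF y(1) y'(1)] A.a_closed[OF y(2) y'(2)] by blast
  qed
qed

lemma p_power_cancel:
  assumes "x \<in> carrier W" "add_pow W (p ^ n) \<one>\<^bsub>W\<^esub> \<otimes>\<^bsub>W\<^esub> x = \<zero>\<^bsub>W\<^esub>"
  shows "x = \<zero>\<^bsub>W\<^esub>"
  using assms(2)
proof (induction n)
  case (Suc n)
  have "add_pow W p \<one>\<^bsub>W\<^esub> \<otimes>\<^bsub>W\<^esub> (add_pow W (p ^ n) \<one>\<^bsub>W\<^esub> \<otimes>\<^bsub>W\<^esub> x) = \<zero>\<^bsub>W\<^esub>"
    using Suc.prems W.m_assoc[of "add_pow W p \<one>\<^bsub>W\<^esub>" "add_pow W (p ^ n) \<one>\<^bsub>W\<^esub>" x] assms(1)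
    unfolding power_Suc W.nat_smult_one_mult by simp
  then have "add_pow W (p ^ n) \<one>\<^bsub>W\<^esub> \<otimes>\<^bsub>W\<^esub> x = \<zero>\<^bsub>W\<^esub>"
    by (rule W.p_not_zero_divisor[rotated]) (use assms(1) in simp)
  then show ?case by (rule Suc.IH)
qed (use assms(1) in simp)

lemma \<alpha>_mem_\<aa>_iff:
  assumes "n \<ge> 1" and "a \<in> carrier A"
  shows "\<alpha> a \<in> \<aa> n \<longleftrightarrow> a \<in> ideal_power A I n"
  using assms
proof (induction n arbitrary: a rule: dec_induct)
  case base
  then show ?case using \<alpha>_mem_\<aa>_1_iff[of a] A.ideal_power_1[OF I_ideal] by simp
next
  case (step n)
  interpret P: ideal "ideal_power A I n" A by (rule A.ideal_power_ideal[OF I_ideal])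
  interpret P': ideal "ideal_power A I (Suc n)" A by (rule A.ideal_power_ideal[OF I_ideal])
  interpret I: ideal I A by (rule I_ideal)
  interpret B: ideal "\<aa> (Suc n)" W by (rule W.ideal_seq) simp
  have le: "\<alpha> c \<in> \<aa> (Suc n)" if "c \<in> ideal_power A I (Suc n)" for c
  proof -
    \<comment> \<open>Carrier membership is carried along because additivity of
      \<open>\<alpha>\<close> needs it in the case of sums.\<close>
    have "c \<in> carrier A \<and> \<alpha> c \<in> \<aa> (Suc n)"
      using that unfolding A.ideal_power_Suc
    proof (induction c rule: ideal_prod.induct)
      case (prod i j)
      have ij: "i \<in> carrier A" "j \<in> carrier A" using prod P.Icarr I.Icarr by auto
      have "\<alpha> i \<in> \<aa> n" "\<alpha> j \<in> \<aa> 1"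
        using prod step.IH[OF ij(1)] \<alpha>_mem_\<aa>_1_iff[OF ij(2)] by auto
      then have "\<alpha> i \<otimes>\<^bsub>W\<^esub> \<alpha> j \<in> \<aa> n \<cdot>\<^bsub>W\<^esub> \<aa> 1" by (rule ideal_prod.prod)
      then show ?case using W.ideal_prod_le[OF step(1) order_refl] ij by auto
    next
      case (sum s1 s2)
      then show ?case by simp
    qed
    then show ?thesis ..
  qed
  show ?case
  proof
    assume "a \<in> ideal_power A I (Suc n)" then show "\<alpha> a \<in> \<aa> (Suc n)" by (rule le)
  next
    assume \<alpha>a: "\<alpha> a \<in> \<aa> (Suc n)"
    then have "a \<in> ideal_power A I n" using step.IH[OF step.prems] W.decreasing[OF step(1)] by blast
    \<comment> \<open>As \<open>y\<close> already maps into \<open>\<aa> (Suc n)\<close>, the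
      question reduces to the term \<open>p^n z\<close>; cancelling \<open>p^n\<close> in
      \<open>W\<close> gives \<open>z\<close> in \<open>I\<close>.\<close>
    then obtain y z where y: "y \<in> ideal_power A I (Suc n)" and z: "z \<in> carrier A"
      and a_eq: "a = y \<oplus>\<^bsub>A\<^esub> add_pow A (p ^ n) \<one>\<^bsub>A\<^esub> \<otimes>\<^bsub>A\<^esub> z"
      using ideal_power_decomp[OF step(1)] by blast
    let ?q = "add_pow W (p ^ n) \<one>\<^bsub>W\<^esub>" and ?p = "add_pow W p \<one>\<^bsub>W\<^esub>"
    have yc: "y \<in> carrier A" using y P'.Icarr by blast
    have "\<alpha> a = \<alpha> y \<oplus>\<^bsub>W\<^esub> ?q \<otimes>\<^bsub>W\<^esub> \<alpha> z"
      unfolding a_eq using yc z by (simp add: \<alpha>.hom_nat_smult_one)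
    then have "?q \<otimes>\<^bsub>W\<^esub> \<alpha> z = \<alpha> a \<oplus>\<^bsub>W\<^esub> \<ominus>\<^bsub>W\<^esub> \<alpha> y"
      using yc z by (simp add: W.a_ac W.r_neg1 W.r_neg2)
    also have "\<dots> \<in> \<aa> (Suc n)" using \<alpha>a le[OF y] by simp
    finally obtain w where w: "w \<in> carrier W" "?q \<otimes>\<^bsub>W\<^esub> \<alpha> z = add_pow W (p ^ Suc n) \<one>\<^bsub>W\<^esub> \<otimes>\<^bsub>W\<^esub> w"
      using mem_\<aa>_iff[of "Suc n"] by auto
    have "add_pow W (p ^ Suc n) \<one>\<^bsub>W\<^esub> = ?q \<otimes>\<^bsub>W\<^esub> ?p"
      unfolding W.nat_smult_one_mult[symmetric] by (simp add: mult.commute)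
    with w(2) have "?q \<otimes>\<^bsub>W\<^esub> (\<alpha> z \<ominus>\<^bsub>W\<^esub> ?p \<otimes>\<^bsub>W\<^esub> w) = \<zero>\<^bsub>W\<^esub>"
      using z w(1) by (simp add: W.minus_eq W.r_distr W.r_minus W.m_assoc W.r_neg)
    then have "\<alpha> z = ?p \<otimes>\<^bsub>W\<^esub> w"
      using p_power_cancel[of "\<alpha> z \<ominus>\<^bsub>W\<^esub> ?p \<otimes>\<^bsub>W\<^esub> w" n] z w(1) by simp
    then have "\<alpha> z \<in> \<aa> 1" using mem_\<aa>_iff[of 1] w(1) by auto
    then have "z \<in> I" using \<alpha>_mem_\<aa>_1_iff[OF z] by blast
    then have "add_pow A (p ^ n) \<one>\<^bsub>A\<^esub> \<otimes>\<^bsub>A\<^esub> z \<in> ideal_power A I (Suc n)"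
      unfolding A.ideal_power_Suc
      by (intro ideal_prod.prod A.nat_smult_one_mem_ideal_power[OF I_ideal p_mem_I])
    then show "a \<in> ideal_power A I (Suc n)" unfolding a_eq using y by simp
  qed
qed

text \<open>A \<open>p\<close>-adic expansion with Teichmueller digits: the error
  \<open>p^n y\<close> is corrected by \<open>p^n\<close> times the generator of the residue of
  \<open>y\<close>, which leaves an error divisible by \<open>p^(n+1)\<close>.\<close>

lemma \<alpha>_dense:
  assumes "n \<ge> 1" and w: "w \<in> carrier W"
  shows "\<exists>a\<in>carrier A. \<alpha> a \<ominus>\<^bsub>W\<^esub> w \<in> \<aa> n"
  using assms(1)
proof (induction n rule: dec_induct)
  case base
  have "\<alpha> (frag_of (q w)) \<ominus>\<^bsub>W\<^esub> w \<in> \<aa> 1"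
    using q_eq_iff[of "teichmueller (q w)" w] w by (simp add: \<alpha>_of q_teichmueller teichmueller_closed)
  then show ?case using frag_of_mem w q.hom_closed by blast
next
  case (step n)
  let ?q = "add_pow W (p ^ n) \<one>\<^bsub>W\<^esub>" and ?p = "add_pow W p \<one>\<^bsub>W\<^esub>"
  let ?qA = "add_pow A (p ^ n) \<one>\<^bsub>A\<^esub>"
  obtain a where a: "a \<in> carrier A" "\<alpha> a \<ominus>\<^bsub>W\<^esub> w \<in> \<aa> n" using step.IH by blast
  then obtain y where y: "y \<in> carrier W" "\<alpha> a \<ominus>\<^bsub>W\<^esub> w = ?q \<otimes>\<^bsub>W\<^esub> y"
    using mem_\<aa>_iff[OF step(1)] by blast
  define b where "b = frag_of (q y)"
  have b: "b \<in> carrier A" unfolding b_def using frag_of_mem y by simp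
  have "\<alpha> b \<ominus>\<^bsub>W\<^esub> y \<in> \<aa> 1"
    unfolding b_def using q_eq_iff[of "teichmueller (q y)" y] y
    by (simp add: \<alpha>_of q_teichmueller teichmueller_closed)
  then have "y \<ominus>\<^bsub>W\<^esub> \<alpha> b \<in> \<aa> 1" using ideal.congr_sym[OF W.ideal_seq] b y(1) by simp
  then obtain u where u: "u \<in> carrier W" "y \<ominus>\<^bsub>W\<^esub> \<alpha> b = ?p \<otimes>\<^bsub>W\<^esub> u"
    using mem_\<aa>_iff[of 1] by auto
  have "\<alpha> (a \<ominus>\<^bsub>A\<^esub> ?qA \<otimes>\<^bsub>A\<^esub> b) \<ominus>\<^bsub>W\<^esub> w = (\<alpha> a \<ominus>\<^bsub>W\<^esub> w) \<ominus>\<^bsub>W\<^esub> ?q \<otimes>\<^bsub>W\<^esub> \<alpha> b"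
    using a(1) b w by (simp add: a_minus_def \<alpha>.hom_nat_smult_one W.a_ac)
  also have "\<dots> = ?q \<otimes>\<^bsub>W\<^esub> (y \<ominus>\<^bsub>W\<^esub> \<alpha> b)"
    unfolding y(2) using y(1) b by (simp add: a_minus_def W.r_distr W.r_minus)
  also have "\<dots> = add_pow W (p ^ Suc n) \<one>\<^bsub>W\<^esub> \<otimes>\<^bsub>W\<^esub> u"
    unfolding u(2) power_Suc2 W.nat_smult_one_mult using u(1) by (simp add: W.m_assoc)
  finally have "\<alpha> (a \<ominus>\<^bsub>A\<^esub> ?qA \<otimes>\<^bsub>A\<^esub> b) \<ominus>\<^bsub>W\<^esub> w \<in> \<aa> (Suc n)"
    using mem_\<aa>_iff[of "Suc n"] u(1) by auto
  moreover have "a \<ominus>\<^bsub>A\<^esub> ?qA \<otimes>\<^bsub>A\<^esub> b \<in> carrier A" using a(1) b by simp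
  ultimately show ?case by blast
qed

lemma adic_approximation_monoid_algebra: "adic_approximation A W \<alpha> p \<aa> I"
  by (intro adic_approximation.intro adic_approximation_axioms.intro
      \<alpha>.ring_hom_cring_axioms W.p_ring_axioms I_ideal \<alpha>_mem_\<aa>_iff \<alpha>_dense)

lemma C_ring_iso_and_strict: "C_ring R \<simeq> W \<and> strict_p_ring (C_ring R) p (C_ideal R)"
proof -
  interpret adic_approximation A W \<alpha> p \<aa> I by (rule adic_approximation_monoid_algebra)
  \<comment> \<open>\<open>strict_p_ring_iso\<close> expects a map into the known strict p-ring,
    hence the inverse direction.\<close>
  define \<Psi> where "\<Psi> = inv_into (carrier W) completion_map"
  have \<Psi>: "\<Psi> \<in> ring_iso (C_ring R) W"
    unfolding \<Psi>_def C_ring_def by (rule ring_iso_set_sym[OF W.ring_axioms completion_map_iso])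
  have \<Psi>_inv: "completion_map (\<Psi> x) = x" if "x \<in> carrier (C_ring R)" for x
    unfolding \<Psi>_def using ring_iso_memE(5)[OF completion_map_iso] that
    by (simp add: C_ring_def bij_betw_inv_into_right)
  have "strict_p_ring (C_ring R) p (C_ideal R)"
  proof (rule strict_p_ring_iso[OF W.strict_p_ring_axioms _ \<Psi>])
    show "cring (C_ring R)" unfolding C_ring_def by (rule adic_completion_cring)
    fix i :: nat assume i: "i \<ge> 1"
    have "x \<in> C_ideal R i \<longleftrightarrow> \<Psi> x \<in> \<aa> i" if x: "x \<in> carrier (C_ring R)" for x
      using completion_map_mem_iff[OF i ring_iso_memE(1)[OF \<Psi> x]] \<Psi>_inv[OF x]
      by (simp add: C_ideal_def)
    moreover have "C_ideal R i \<subseteq> carrier (C_ring R)"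
      unfolding C_ideal_def C_ring_def completed_ideal_power_def by blast
    ultimately show "C_ideal R i = {x \<in> carrier (C_ring R). \<Psi> x \<in> \<aa> i}" by blast
  qed
  then show ?thesis using \<Psi> unfolding is_ring_iso_def by blast
qed

end

theorem mainTheorem2:
  fixes p :: nat
    and R :: "('a, 'm) ring_scheme"
    and W :: "('b, 'n) ring_scheme"
    and \<aa> :: "nat \<Rightarrow> 'b set"
  assumes "Factorial_Ring.prime p"
    and "perfect_Fp_algebra p R"
    and "strict_p_ring W p \<aa>"
    and "(W Quot \<aa> 1) \<simeq> R"
  shows "C_ring R \<simeq> W \<and> strict_p_ring (C_ring R) p (C_ideal R)"
proof -
  interpret W: strict_p_ring W p \<aa> by fact
  interpret R: cring R using assms(2) unfolding perfect_Fp_algebra_def Fp_algebra_def by blast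
  interpret J: ideal "\<aa> 1" W by (rule W.ideal_seq) simp
  interpret Q: ring "W Quot \<aa> 1" by (rule J.quotient_is_ring)
  obtain \<theta> where \<theta>: "\<theta> \<in> ring_iso (W Quot \<aa> 1) R" using assms(4) unfolding is_ring_iso_def by blast
  then have \<theta>_hom: "\<theta> \<in> ring_hom (W Quot \<aa> 1) R"
    and \<theta>_bij: "bij_betw \<theta> (carrier (W Quot \<aa> 1)) (carrier R)"
    unfolding ring_iso_def by auto
  interpret \<theta>: ring_hom_ring "W Quot \<aa> 1" R \<theta> by unfold_locales (rule \<theta>_hom)
  \<comment> \<open>Reduction followed by the given isomorphism; its kernel is
    \<open>\<aa> 1\<close> because \<open>\<theta>\<close> is injective.\<close>
  define q where "q = \<theta> \<circ> (+>\<^bsub>W\<^esub>) (\<aa> 1)"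
  have q: "q \<in> ring_hom W R" unfolding q_def by (rule ring_hom_trans[OF J.rcos_ring_hom \<theta>_hom])
  have Q_carrier: "carrier (W Quot \<aa> 1) = (+>\<^bsub>W\<^esub>) (\<aa> 1) ` carrier W"
    unfolding FactRing_def A_RCOSETS_def' by auto
  interpret strict_p_ring_residue W R p \<aa> q
  proof (intro strict_p_ring_residue.intro strict_p_ring_residue_axioms.intro ring_hom_cring.intro
      ring_hom_cring_axioms.intro)
    show "q ` carrier W = carrier R"
      using bij_betw_imp_surj_on[OF \<theta>_bij] unfolding q_def Q_carrier by (simp add: image_comp)
    fix w assume w: "w \<in> carrier W"
    have "q w = \<zero>\<^bsub>R\<^esub> \<longleftrightarrow> \<theta> (\<aa> 1 +>\<^bsub>W\<^esub> w) = \<theta> \<zero>\<^bsub>W Quot \<aa> 1\<^esub>"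
      unfolding q_def \<theta>.hom_zero by simp
    also have "\<dots> \<longleftrightarrow> \<aa> 1 +>\<^bsub>W\<^esub> w = \<zero>\<^bsub>W Quot \<aa> 1\<^esub>"
      using inj_on_eq_iff[OF bij_betw_imp_inj_on[OF \<theta>_bij]] Q.zero_closed w unfolding Q_carrier by blast
    also have "\<dots> \<longleftrightarrow> w \<in> \<aa> 1"
      using W.a_coset_join1[OF _ w J.a_subgroup] W.a_coset_join2[OF w J.a_subgroup]
      by (auto simp: FactRing_def)
    finally show "q w = \<zero>\<^bsub>R\<^esub> \<longleftrightarrow> w \<in> \<aa> 1" .
  qed (fact assms q W.cring_axioms R.cring_axioms)+
  show ?thesis by (rule C_ring_iso_and_strict)
qed

end
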